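(* Let $(Y_i,X_i)_{1\le i\le n}$ be independent copies of $(Y,X)\in\{0,1\}\times\mathbb{R}^p$, let $\pi(z)=\mathbb{P}(Y=1\mid X=z)$ and $\ell=\operatorname{logit}\pi=\log(\pi/(1-\pi))$. Fix $x\in\mathbb{R}^p$ and suppose that: (A1) the distribution of $X$ has a continuous density $f_X$ with respect to Lebesgue measure on $\mathbb{R}^p$, and $f_X(x)>0$; (A2) the function $\pi:\mathbb{R}^p\to[0,1]$ is twice differentiable with continuous second order derivatives at $x$, and $\pi(x)\in(0,1)$. If $k:=k_n\to\infty$ and $\lambda:=\lambda_n$ are such that $k^{1+p/2}/n\to\infty$, $k^{1+p/4}/n$ is bounded and $n\lambda^p/k^{1+p/2}\to c\in[0,\infty)$, then $\widehat{b}_n(x)$ is a consistent estimator of $\nabla\ell(x)$, and $$\widehat{b}_n(x)-\nabla\ell(x)=O_{\mathbb{P}}\left(\frac{1}{\tau_{n,k}(x)\sqrt{k}}\right)+O_{\mathbb{P}}(\tau_{n,k}(x)).$$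
   Context: $\|\cdot\|_1$ is the $\ell_1$ norm, $\operatorname{expit}(t)=e^t/(1+e^t)$, $V_p$ is the volume of the Euclidean unit ball of $\mathbb{R}^p$, $k_n\in\{1,\dots,n\}$, $\lambda_n\ge0$, and $\tau_{n,k}(x)=\left(\frac{k}{n}\frac{1}{f_X(x)V_p}\right)^{1/p}$. $N_k(x)\subset\{1,\dots,n\}$ is the set of indices of the $k$ nearest neighbors $X_i$ of $x$ in Euclidean distance (almost surely there are no ties). The estimator is $$(\widehat{a}_n(x),\widehat{b}_n(x))=\operatorname*{arg\,max}_{(a,b)\in\mathbb{R}\times\mathbb{R}^p}\{L_n(a,b)-\lambda\|b\|_1\},$$ $$L_n(a,b)=\sum_{i\in N_k(x)}\Big\{Y_i\log(\operatorname{expit}(a+b^T(X_i-x)))+(1-Y_i)\log(1-\operatorname{expit}(a+b^T(X_i-x)))\Big\},$$ understood as a measurable choice of maximizer, with an arbitrary value on the event where no maximizer exists. Consistency means convergence in probability; $O_{\mathbb{P}}$ is as $n\to\infty$. *)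

theory Defs
  imports "HOL-Probability.Probability"
begin

definition expit :: "real \<Rightarrow> real" where
  "expit t = exp t / (1 + exp t)"

definition logit :: "real \<Rightarrow> real" where
  "logit u = ln (u / (1 - u))"

definition l1_norm :: "real ^ 'p \<Rightarrow> real" where
  "l1_norm b = (\<Sum>j\<in>UNIV. \<bar>b $ j\<bar>)"

definition gradient :: "('a::real_inner \<Rightarrow> real) \<Rightarrow> 'a \<Rightarrow> 'a" where
  "gradient f x = (THE D. GDERIV f x :> D)"

lemma gradient_eqI:
  assumes "GDERIV f x :> D"
  shows "gradient f x = D"
  unfolding gradient_def
proof (rule the_equality)
  show "GDERIV f x :> D" by (fact assms)
next
  fix D' assume "GDERIV f x :> D'"
  then have "(\<lambda>h. h \<bullet> D') = (\<lambda>h. h \<bullet> D)"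
    using assms unfolding gderiv_def by (rule has_derivative_unique)
  then have "\<And>h. h \<bullet> (D' - D) = 0"
    by (metis inner_diff_right right_minus_eq)
  then have "(D' - D) \<bullet> (D' - D) = 0" .
  then show "D' = D" by simp
qed

(* The second derivatives need to exist only near x, and to be continuous only at x. *)
definition C2_at :: "(real ^ 'p \<Rightarrow> real) \<Rightarrow> real ^ 'p \<Rightarrow> bool" where
  "C2_at f x \<longleftrightarrow> (\<exists>U g (H :: real ^ 'p \<Rightarrow> real ^ 'p ^ 'p). open U \<and> x \<in> U \<and>
     (\<forall>z\<in>U. GDERIV f z :> g z) \<and>
     (\<forall>z\<in>U. (g has_derivative (\<lambda>h. H z *v h)) (at z)) \<and>
     isCont H x)"

(* r is a version of z \<mapsto> P(Y = 1 | X = z) with values in [0,1]. *)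
definition is_regression_function ::
  "'w measure \<Rightarrow> ('w \<Rightarrow> real) \<Rightarrow> ('w \<Rightarrow> real ^ 'p) \<Rightarrow> (real ^ 'p \<Rightarrow> real) \<Rightarrow> bool" where
  "is_regression_function M Y X r \<longleftrightarrow>
     r \<in> borel_measurable borel \<and> (\<forall>z. 0 \<le> r z \<and> r z \<le> 1) \<and>
     (AE \<omega> in M. real_cond_exp M (vimage_algebra (space M) X borel)
        (indicator {\<omega> \<in> space M. Y \<omega> = 1}) \<omega> = r (X \<omega>))"

definition independent_copies ::
  "'w measure \<Rightarrow> (nat \<Rightarrow> 'w \<Rightarrow> real) \<Rightarrow> (nat \<Rightarrow> 'w \<Rightarrow> real ^ 'p)
     \<Rightarrow> ('w \<Rightarrow> real) \<Rightarrow> ('w \<Rightarrow> real ^ 'p) \<Rightarrow> bool" where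
  "independent_copies M Ys Xs Y X \<longleftrightarrow>
     prob_space.indep_vars M (\<lambda>_. borel \<Otimes>\<^sub>M borel) (\<lambda>i \<omega>. (Ys i \<omega>, Xs i \<omega>)) {1..} \<and>
     (\<forall>i\<ge>1. distr M (borel \<Otimes>\<^sub>M borel) (\<lambda>\<omega>. (Ys i \<omega>, Xs i \<omega>))
           = distr M (borel \<Otimes>\<^sub>M borel) (\<lambda>\<omega>. (Y \<omega>, X \<omega>)))"

(* Ties in distance are broken by the index, so that the set always has k elements if k \<le> n. *)
definition nearest_neighbors :: "(nat \<Rightarrow> real ^ 'p) \<Rightarrow> nat \<Rightarrow> nat \<Rightarrow> real ^ 'p \<Rightarrow> nat set" where
  "nearest_neighbors xs n k x =
     {i \<in> {1..n}. card {j \<in> {1..n}. dist (xs j) x < dist (xs i) x \<or>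
                                    (dist (xs j) x = dist (xs i) x \<and> j < i)} < k}"

definition local_loglik ::
  "(nat \<Rightarrow> real) \<Rightarrow> (nat \<Rightarrow> real ^ 'p) \<Rightarrow> nat \<Rightarrow> nat \<Rightarrow> real ^ 'p \<Rightarrow> real \<Rightarrow> real ^ 'p \<Rightarrow> real" where
  "local_loglik ys xs n k x a b =
     (\<Sum>i\<in>nearest_neighbors xs n k x.
        ys i * ln (expit (a + b \<bullet> (xs i - x))) +
        (1 - ys i) * ln (1 - expit (a + b \<bullet> (xs i - x))))"

definition is_maximizer ::
  "(nat \<Rightarrow> real) \<Rightarrow> (nat \<Rightarrow> real ^ 'p) \<Rightarrow> nat \<Rightarrow> nat \<Rightarrow> real \<Rightarrow> real ^ 'p \<Rightarrow> real \<times> (real ^ 'p) \<Rightarrow> bool"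
  where
  "is_maximizer ys xs n k lam x =
     is_arg_max (\<lambda>(a, b). local_loglik ys xs n k x a b - lam * l1_norm b) (\<lambda>_. True)"

(* No constraint where there is no maximizer; the almost sure quantifier makes the
   notion independent of how ties in distance are broken when X has a density. *)
definition is_estimator ::
  "'w measure \<Rightarrow> (nat \<Rightarrow> 'w \<Rightarrow> real) \<Rightarrow> (nat \<Rightarrow> 'w \<Rightarrow> real ^ 'p) \<Rightarrow> nat \<Rightarrow> nat \<Rightarrow> real
     \<Rightarrow> real ^ 'p \<Rightarrow> ('w \<Rightarrow> real) \<Rightarrow> ('w \<Rightarrow> real ^ 'p) \<Rightarrow> bool" where
  "is_estimator M Ys Xs n k lam x a b \<longleftrightarrow>
     a \<in> borel_measurable M \<and> b \<in> borel_measurable M \<and>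
     (AE \<omega> in M. (\<exists>ab. is_maximizer (\<lambda>i. Ys i \<omega>) (\<lambda>i. Xs i \<omega>) n k lam x ab) \<longrightarrow>
        is_maximizer (\<lambda>i. Ys i \<omega>) (\<lambda>i. Xs i \<omega>) n k lam x (a \<omega>, b \<omega>))"

definition tau :: "(real ^ 'p \<Rightarrow> real) \<Rightarrow> nat \<Rightarrow> nat \<Rightarrow> real ^ 'p \<Rightarrow> real" where
  "tau f n k x = (real k / real n * (1 / (f x * measure lborel (ball (0 :: real ^ 'p) 1))))
                   powr (1 / real CARD('p))"

(* Measurability is required because measure is 0 on non-measurable sets. *)
definition converges_in_prob ::
  "'w measure \<Rightarrow> (nat \<Rightarrow> 'w \<Rightarrow> 'b::euclidean_space) \<Rightarrow> 'b \<Rightarrow> bool" where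
  "converges_in_prob M Z v \<longleftrightarrow>
     (\<forall>\<^sub>F n in sequentially. Z n \<in> borel_measurable M) \<and>
     (\<forall>\<epsilon>>0. (\<lambda>n. measure M {\<omega> \<in> space M. dist (Z n \<omega>) v > \<epsilon>}) \<longlonglongrightarrow> 0)"

definition bigO_prob ::
  "'w measure \<Rightarrow> (nat \<Rightarrow> 'w \<Rightarrow> 'b::euclidean_space) \<Rightarrow> (nat \<Rightarrow> real) \<Rightarrow> bool" where
  "bigO_prob M Z r \<longleftrightarrow>
     (\<forall>\<^sub>F n in sequentially. Z n \<in> borel_measurable M) \<and>
     (\<forall>\<epsilon>>0. \<exists>C. \<forall>\<^sub>F n in sequentially. measure M {\<omega> \<in> space M. norm (Z n \<omega>) > C * r n} \<le> \<epsilon>)"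

end

theory Submission
  imports Defs
begin

text \<open>
  Put \<open>\<tau> = \<tau>_{n,k}(x)\<close>, \<open>a\<^sub>0 = logit (\<pi> x)\<close>, \<open>b\<^sub>0 = \<nabla>\<ell>(x)\<close>, and measure the distance of \<open>(a, b)\<close> from
  \<open>(a\<^sub>0, b\<^sub>0)\<close> by \<open>N = |a - a\<^sub>0| + \<tau> |b - b\<^sub>0|\<^sub>1\<close>. The penalized likelihood exceeds its value
  at \<open>(a\<^sub>0, b\<^sub>0)\<close> by at most \<open>c\<^sub>1 \<surd>k N - c\<^sub>2 k N\<^sup>2\<close>. The linear term comes from the noise, from the
  bias (\<open>k\<close> terms of order \<open>\<tau>\<^sup>2\<close>, where \<open>\<tau>\<^sup>2 \<surd>k\<close> is bounded) and from the penalty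
  (\<open>\<lambda> = O(\<tau> \<surd>k)\<close>); the quadratic one from the strong convexity of \<open>ln (1 + e^t)\<close> on bounded
  intervals. By concavity, with probability close to 1 every maximizer then satisfies
  \<open>N \<le> D / \<surd>k\<close>, so \<open>b - b\<^sub>0\<close> is of order \<open>1 / (\<tau> \<surd>k)\<close>.

  The noise has second moment at most a multiple of \<open>k\<close> because the residuals are orthogonal given
  the covariates, also after the covariate-dependent selection of the neighbors. The quadratic lower
  bound needs only that a positive fraction of the neighbors lies in each of the \<open>2p\<close> small balls
  centered at \<open>x \<plusminus> (\<tau>/4) e\<^sub>j\<close>, which is Chebyshev's inequality for counts.
\<close>

section \<open>The penalized likelihood\<close>

text \<open>The log-partition function of the Bernoulli family in its natural parameter: the first
  derivative \<open>expit\<close> is the mean, the second derivative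
  \<open>expit t * (1 - expit t)\<close> the variance.\<close>

definition softplus :: "real \<Rightarrow> real" where
  "softplus t = ln (1 + exp t)"

lemma one_plus_exp_pos: "0 < 1 + exp (t::real)" "1 + exp (t::real) \<noteq> 0"
  using exp_gt_zero[of t] by (linarith, linarith)

lemma one_minus_expit: "1 - expit t = 1 / (1 + exp t)"
  using one_plus_exp_pos[of t] by (simp add: expit_def field_simps)

lemma expit_bounds: "0 < expit t" "expit t < 1"
  using one_plus_exp_pos[of t] by (simp_all add: expit_def)

lemma bernoulli_loglik_eq:
  "y * ln (expit t) + (1 - y) * ln (1 - expit t) = y * t - softplus t"
  unfolding one_minus_expit
  by (simp add: expit_def softplus_def ln_div one_plus_exp_pos algebra_simps)

lemma DERIV_softplus: "(softplus has_real_derivative expit t) (at t)"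
  unfolding softplus_def[abs_def] expit_def
  by (auto intro!: derivative_eq_intros simp: one_plus_exp_pos)

lemma DERIV_expit: "(expit has_real_derivative expit t * (1 - expit t)) (at t)"
  unfolding one_minus_expit unfolding expit_def[abs_def]
  by (auto intro!: derivative_eq_intros simp: one_plus_exp_pos field_simps)

lemma expit_logit:
  assumes "0 < u" "u < 1"
  shows "expit (logit u) = u"
  using assms by (simp add: expit_def logit_def field_simps)

text \<open>Taylor's formula with Lagrange remainder: the intermediate point lies between
  \<open>u\<close> and \<open>u + h\<close>, where the second derivative is at least
  \<open>\<kappa>\<close>.\<close>

lemma softplus_quadratic_lower:
  assumes "\<And>s. \<bar>s - u\<bar> \<le> \<bar>h\<bar> \<Longrightarrow> \<kappa> \<le> expit s * (1 - expit s)"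
  shows "softplus u + expit u * h + \<kappa> / 2 * h\<^sup>2 \<le> softplus (u + h)"
proof (cases "h = 0")
  case False
  \<comment> \<open>The derivatives of \<open>softplus\<close> in the indexed form expected by
    \<open>Taylor\<close>; only indices up to 2 matter. The case \<open>h = 0\<close> is separate
    because \<open>Taylor\<close> needs two distinct points.\<close>
  define diff where
    "diff m = (if m = 0 then softplus else if m = 1 then expit else (\<lambda>t. expit t * (1 - expit t)))"
    for m :: nat
  have "\<exists>t. (if u + h < u then u + h < t \<and> t < u else u < t \<and> t < u + h) \<and>
      softplus (u + h) = (\<Sum>m<2. diff m u / fact m * (u + h - u) ^ m) +
        diff 2 t / fact 2 * (u + h - u) ^ 2"
  proof (rule Taylor[where a = "u - \<bar>h\<bar>" and b = "u + \<bar>h\<bar>"])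
    show "\<forall>m t. m < 2 \<and> u - \<bar>h\<bar> \<le> t \<and> t \<le> u + \<bar>h\<bar> \<longrightarrow> DERIV (diff m) t :> diff (Suc m) t"
      by (auto simp: diff_def less_2_cases_iff DERIV_softplus DERIV_expit)
  qed (use False in \<open>auto simp: diff_def\<close>)
  then obtain t where t: "if u + h < u then u + h < t \<and> t < u else u < t \<and> t < u + h"
    "softplus (u + h) = softplus u + expit u * h + expit t * (1 - expit t) / 2 * h\<^sup>2"
    by (auto simp: diff_def numeral_2_eq_2)
  have "\<bar>t - u\<bar> \<le> \<bar>h\<bar>"
    using t(1) by (auto split: if_splits)
  then have "\<kappa> / 2 * h\<^sup>2 \<le> expit t * (1 - expit t) / 2 * h\<^sup>2"
    by (intro mult_right_mono divide_right_mono assms) auto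
  then show ?thesis
    using t(2) by linarith
qed simp

lemma convex_softplus: "convex_on UNIV softplus"
  by (rule f''_ge0_imp_convex[where f' = expit and f'' = "\<lambda>t. expit t * (1 - expit t)"])
     (auto intro!: DERIV_softplus DERIV_expit mult_nonneg_nonneg simp: expit_bounds less_imp_le)

section \<open>Elementary properties of the l1 norm and convexity along segments\<close>

lemma l1_norm_nonneg: "0 \<le> l1_norm b"
  by (simp add: l1_norm_def sum_nonneg)

lemma l1_norm_triangle: "l1_norm (a + b) \<le> l1_norm a + l1_norm b"
  unfolding l1_norm_def sum.distrib[symmetric] by (intro sum_mono) auto

lemma l1_norm_scaleR: "l1_norm (t *\<^sub>R b) = \<bar>t\<bar> * l1_norm b"
  by (simp add: l1_norm_def abs_mult sum_distrib_left)

lemma l1_norm_minus_commute: "l1_norm (a - b) = l1_norm (b - a)"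
  by (simp add: l1_norm_def abs_minus_commute)

lemma norm_le_l1_norm: "norm b \<le> l1_norm b"
  unfolding l1_norm_def by (rule norm_le_l1_cart)

lemma continuous_on_l1_norm [continuous_intros]:
  "continuous_on S f \<Longrightarrow> continuous_on S (\<lambda>x. l1_norm (f x))"
  unfolding l1_norm_def by (intro continuous_intros)

lemma continuous_on_softplus [continuous_intros]:
  "continuous_on S f \<Longrightarrow> continuous_on S (\<lambda>x. softplus (f x))"
  unfolding softplus_def by (intro continuous_intros) (auto simp: one_plus_exp_pos)

lemma l1_norm_convex:
  assumes "0 \<le> t" "t \<le> 1"
  shows "l1_norm (b0 + t *\<^sub>R (b - b0)) \<le> (1 - t) * l1_norm b0 + t * l1_norm b"
proof -
  have "b0 + t *\<^sub>R (b - b0) = (1 - t) *\<^sub>R b0 + t *\<^sub>R b"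
    by (simp add: algebra_simps)
  then show ?thesis
    using l1_norm_triangle[of "(1 - t) *\<^sub>R b0" "t *\<^sub>R b"] assms by (simp add: l1_norm_scaleR)
qed

lemma softplus_convex:
  assumes "0 \<le> t" "t \<le> 1"
  shows "softplus (u + t * (v - u)) \<le> (1 - t) * softplus u + t * softplus v"
proof -
  have "u + t * (v - u) = (1 - t) *\<^sub>R u + t *\<^sub>R v"
    by (simp add: algebra_simps)
  then show ?thesis
    using convex_onD[OF convex_softplus, of t u v] assms by simp
qed

section \<open>Concavity, local expansion and localization of maximizers\<close>

definition penalized_loglik ::
  "nat set \<Rightarrow> (nat \<Rightarrow> real) \<Rightarrow> (nat \<Rightarrow> real ^ 'p) \<Rightarrow> real \<Rightarrow> real \<times> (real ^ 'p) \<Rightarrow> real" where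
  "penalized_loglik I y z lam =
     (\<lambda>(a, b). (\<Sum>i\<in>I. y i * (a + b \<bullet> z i) - softplus (a + b \<bullet> z i)) - lam * l1_norm b)"

text \<open>Passes to natural parameters and to an arbitrary index set with centered covariates, so
  that the optimization argument is deterministic and independent of how neighbors are
  selected.\<close>

lemma is_maximizer_iff:
  "is_maximizer ys xs n k lam x ab \<longleftrightarrow>
     is_arg_max (penalized_loglik (nearest_neighbors xs n k x) ys (\<lambda>i. xs i - x) lam) (\<lambda>_. True) ab"
  unfolding is_maximizer_def penalized_loglik_def local_loglik_def bernoulli_loglik_eq ..

text \<open>Each summand is an affine function minus \<open>softplus\<close> of an affine function,
  and \<open>lam \<ge> 0\<close> makes the penalty convex. The form along a segment from
  \<open>(a0, b0)\<close> suits the later restriction to rays.\<close>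

lemma penalized_loglik_concave:
  assumes "0 \<le> t" "t \<le> 1" "0 \<le> lam"
  shows "(1 - t) * penalized_loglik I y z lam (a0, b0) + t * penalized_loglik I y z lam (a, b)
    \<le> penalized_loglik I y z lam (a0 + t * (a - a0), b0 + t *\<^sub>R (b - b0))"
proof -
  let ?l = "\<lambda>i v. y i * v - softplus v"
  have "(1 - t) * (\<Sum>i\<in>I. ?l i (a0 + b0 \<bullet> z i)) + t * (\<Sum>i\<in>I. ?l i (a + b \<bullet> z i))
     = (\<Sum>i\<in>I. (1 - t) * ?l i (a0 + b0 \<bullet> z i) + t * ?l i (a + b \<bullet> z i))"
    by (simp add: sum_distrib_left sum.distrib)
  also have "\<dots> \<le> (\<Sum>i\<in>I. ?l i (a0 + t * (a - a0) + (b0 + t *\<^sub>R (b - b0)) \<bullet> z i))"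
  proof (rule sum_mono)
    fix i
    have eq: "a0 + t * (a - a0) + (b0 + t *\<^sub>R (b - b0)) \<bullet> z i
       = (a0 + b0 \<bullet> z i) + t * ((a + b \<bullet> z i) - (a0 + b0 \<bullet> z i))"
      by (simp add: algebra_simps)
    show "(1 - t) * ?l i (a0 + b0 \<bullet> z i) + t * ?l i (a + b \<bullet> z i)
      \<le> ?l i (a0 + t * (a - a0) + (b0 + t *\<^sub>R (b - b0)) \<bullet> z i)"
      unfolding eq using softplus_convex[OF assms(1,2), of "a0 + b0 \<bullet> z i" "a + b \<bullet> z i"]
      by (simp add: algebra_simps)
  qed
  moreover have "lam * l1_norm (b0 + t *\<^sub>R (b - b0)) \<le> lam * ((1 - t) * l1_norm b0 + t * l1_norm b)"
    by (intro mult_left_mono l1_norm_convex assms)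
  ultimately show ?thesis
    unfolding penalized_loglik_def by (simp add: algebra_simps)
qed

text \<open>Second-order expansion at \<open>(a0, b0)\<close>: the score bounds and the penalty give
  the linear term, the variance bound \<open>\<kappa>\<close> and the curvature \<open>m\<close> the
  quadratic one. \<open>K\<close> plays the role of the square root of the number of
  neighbors.\<close>

lemma penalized_loglik_increment:
  fixes z :: "nat \<Rightarrow> real ^ 'p"
  assumes pos: "0 < \<tau>" "0 < K" "0 \<le> lam"
    and score0: "\<bar>\<Sum>i\<in>I. y i - expit (a0 + b0 \<bullet> z i)\<bar> \<le> A * K"
    and score: "\<And>j. \<bar>\<Sum>i\<in>I. (y i - expit (a0 + b0 \<bullet> z i)) * z i $ j\<bar> \<le> A * K * \<tau>"
    and lam: "lam \<le> L * K * \<tau>"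
    and curv: "\<And>\<alpha> \<beta>. m * K\<^sup>2 * (\<bar>\<alpha>\<bar> + \<tau> * l1_norm \<beta>)\<^sup>2 \<le> (\<Sum>i\<in>I. (\<alpha> + \<beta> \<bullet> z i)\<^sup>2)"
    and near: "\<And>i. i \<in> I \<Longrightarrow> \<bar>b0 \<bullet> z i\<bar> \<le> 1 / 2"
    and small: "\<And>i. i \<in> I \<Longrightarrow> \<bar>(a - a0) + (b - b0) \<bullet> z i\<bar> \<le> 1 / 2"
    and \<kappa>: "0 < \<kappa>" "\<And>s. \<bar>s - a0\<bar> \<le> 1 \<Longrightarrow> \<kappa> \<le> expit s * (1 - expit s)"
    and N: "N = \<bar>a - a0\<bar> + \<tau> * l1_norm (b - b0)"
  shows "penalized_loglik I y z lam (a, b) - penalized_loglik I y z lam (a0, b0)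
    \<le> (A + L) * K * N - \<kappa> * m / 2 * K\<^sup>2 * N\<^sup>2"
proof -
  define \<alpha> \<beta> where "\<alpha> = a - a0" and "\<beta> = b - b0"
  define e where "e i = a0 + b0 \<bullet> z i" for i
  define h where "h i = \<alpha> + \<beta> \<bullet> z i" for i
  have eta: "a + b \<bullet> z i = e i + h i" for i
    by (simp add: e_def h_def \<alpha>_def \<beta>_def algebra_simps)
  have term_le: "y i * (e i + h i) - softplus (e i + h i) - (y i * e i - softplus (e i))
     \<le> (y i - expit (e i)) * h i - \<kappa> / 2 * (h i)\<^sup>2" if "i \<in> I" for i
  proof -
    have "softplus (e i) + expit (e i) * h i + \<kappa> / 2 * (h i)\<^sup>2 \<le> softplus (e i + h i)"
    proof (rule softplus_quadratic_lower)
      \<comment> \<open>The two bounds \<open>1 / 2\<close> add up: every point between the two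
        linear predictors stays within distance 1 of \<open>a0\<close>, where
        \<open>\<kappa>\<close> is valid.\<close>
      fix s assume "\<bar>s - e i\<bar> \<le> \<bar>h i\<bar>"
      then have "\<bar>s - a0\<bar> \<le> 1"
        using near[OF that] small[OF that] unfolding e_def h_def \<alpha>_def \<beta>_def by linarith
      then show "\<kappa> \<le> expit s * (1 - expit s)" by (rule \<kappa>)
    qed
    then show ?thesis by (simp add: algebra_simps)
  qed
  have "(\<Sum>i\<in>I. y i * (e i + h i) - softplus (e i + h i)) - (\<Sum>i\<in>I. y i * e i - softplus (e i))
     = (\<Sum>i\<in>I. y i * (e i + h i) - softplus (e i + h i) - (y i * e i - softplus (e i)))"
    by (simp add: sum_subtractf)
  also have "\<dots> \<le> (\<Sum>i\<in>I. (y i - expit (e i)) * h i - \<kappa> / 2 * (h i)\<^sup>2)"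
    by (rule sum_mono) (rule term_le)
  also have "\<dots> = (\<Sum>i\<in>I. (y i - expit (e i)) * h i) - \<kappa> / 2 * (\<Sum>i\<in>I. (h i)\<^sup>2)"
    by (simp add: sum_subtractf sum_distrib_left)
  finally have step1: "(\<Sum>i\<in>I. y i * (e i + h i) - softplus (e i + h i)) - (\<Sum>i\<in>I. y i * e i - softplus (e i))
     \<le> (\<Sum>i\<in>I. (y i - expit (e i)) * h i) - \<kappa> / 2 * (\<Sum>i\<in>I. (h i)\<^sup>2)" .
  have mult_le: "u * s \<le> \<bar>u\<bar> * B" if "\<bar>s\<bar> \<le> B" for u s B :: real
    by (rule order_trans[OF abs_ge_self]) (simp add: abs_mult mult_left_mono that)
  have "(\<Sum>i\<in>I. (y i - expit (e i)) * h i)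
     = \<alpha> * (\<Sum>i\<in>I. y i - expit (e i)) + (\<Sum>i\<in>I. \<Sum>j\<in>UNIV. \<beta> $ j * ((y i - expit (e i)) * z i $ j))"
  proof -
    have "(y i - expit (e i)) * h i
      = \<alpha> * (y i - expit (e i)) + (\<Sum>j\<in>UNIV. \<beta> $ j * ((y i - expit (e i)) * z i $ j))" for i
    proof -
      have "(y i - expit (e i)) * (\<beta> \<bullet> z i) = (\<Sum>j\<in>UNIV. \<beta> $ j * ((y i - expit (e i)) * z i $ j))"
        unfolding inner_vec_def sum_distrib_left by (rule sum.cong) (simp_all add: mult_ac)
      then show ?thesis unfolding h_def by (simp only: distrib_left mult.commute)
    qed
    then show ?thesis by (simp only: sum.distrib sum_distrib_left)
  qed
  also have "\<dots> = \<alpha> * (\<Sum>i\<in>I. y i - expit (e i)) + (\<Sum>j\<in>UNIV. \<beta> $ j * (\<Sum>i\<in>I. (y i - expit (e i)) * z i $ j))"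
    by (subst sum.swap) (simp add: sum_distrib_left)
  also have "\<dots> \<le> \<bar>\<alpha>\<bar> * (A * K) + (\<Sum>j\<in>UNIV. \<bar>\<beta> $ j\<bar> * (A * K * \<tau>))"
  proof (intro add_mono sum_mono)
    show "\<alpha> * (\<Sum>i\<in>I. y i - expit (e i)) \<le> \<bar>\<alpha>\<bar> * (A * K)"
      using score0 unfolding e_def by (rule mult_le)
    show "\<beta> $ j * (\<Sum>i\<in>I. (y i - expit (e i)) * z i $ j) \<le> \<bar>\<beta> $ j\<bar> * (A * K * \<tau>)" for j
      using score[of j] unfolding e_def by (rule mult_le)
  qed
  also have "\<dots> = A * K * N"
    unfolding N l1_norm_def \<alpha>_def \<beta>_def by (simp add: sum_distrib_left algebra_simps)
  finally have step2: "(\<Sum>i\<in>I. (y i - expit (e i)) * h i) \<le> A * K * N" .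
  have "m * K\<^sup>2 * N\<^sup>2 \<le> (\<Sum>i\<in>I. (h i)\<^sup>2)"
    using curv[of \<alpha> \<beta>] unfolding N h_def \<alpha>_def \<beta>_def .
  then have step3: "\<kappa> / 2 * (m * K\<^sup>2 * N\<^sup>2) \<le> \<kappa> / 2 * (\<Sum>i\<in>I. (h i)\<^sup>2)"
    using \<kappa>(1) by (intro mult_left_mono) auto
  \<comment> \<open>By the triangle inequality, moving from \<open>b0\<close> to \<open>b\<close>
    lowers the penalty by at most \<open>lam * l1_norm \<beta>\<close>.\<close>
  have "l1_norm b0 \<le> l1_norm b + l1_norm \<beta>"
    using l1_norm_triangle[of b "b0 - b"] by (simp add: \<beta>_def l1_norm_minus_commute)
  then have "lam * l1_norm b0 \<le> lam * l1_norm b + lam * l1_norm \<beta>"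
    using pos(3) by (metis distrib_left mult_left_mono)
  moreover have "lam * l1_norm \<beta> \<le> L * K * \<tau> * l1_norm \<beta>"
    by (intro mult_right_mono lam l1_norm_nonneg)
  \<comment> \<open>The sign of \<open>L\<close> follows from
    \<open>0 \<le> lam \<le> L * K * \<tau>\<close>; it permits enlarging
    \<open>\<tau> * l1_norm \<beta>\<close> to \<open>N\<close>.\<close>
  moreover have "0 \<le> L * K"
  proof -
    have "0 \<le> L * K * \<tau>" using pos(3) lam by linarith
    then show ?thesis using pos(1) by (simp add: zero_le_mult_iff)
  qed
  then have "L * K * (\<tau> * l1_norm \<beta>) \<le> L * K * N"
    unfolding N \<beta>_def by (intro mult_left_mono) auto
  ultimately have step4: "lam * l1_norm b0 - lam * l1_norm b \<le> L * K * N"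
    by (simp add: mult.assoc)
  have "penalized_loglik I y z lam (a, b)
      = (\<Sum>i\<in>I. y i * (e i + h i) - softplus (e i + h i)) - lam * l1_norm b"
    "penalized_loglik I y z lam (a0, b0) = (\<Sum>i\<in>I. y i * e i - softplus (e i)) - lam * l1_norm b0"
    unfolding penalized_loglik_def by (simp_all add: eta e_def)
  moreover have "\<kappa> * m / 2 * K\<^sup>2 * N\<^sup>2 = \<kappa> / 2 * (m * K\<^sup>2 * N\<^sup>2)"
    "(A + L) * K * N = A * K * N + L * K * N"
    by (simp_all add: algebra_simps)
  ultimately show ?thesis
    using step1 step2 step3 step4 by linarith
qed

text \<open>The two conditions on \<open>D\<close> concern the sphere \<open>N = D / K\<close>. The
  first keeps the linear predictors within \<open>4 * N \<le> 1 / 2\<close> of their central values,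
  so that the local expansion applies; the second makes the quadratic loss exceed the linear gain
  there.\<close>

lemma penalized_maximizer_localized:
  fixes z :: "nat \<Rightarrow> real ^ 'p"
  assumes pos: "0 < \<tau>" "0 < K" "0 \<le> lam" "0 < D"
    and score0: "\<bar>\<Sum>i\<in>I. y i - expit (a0 + b0 \<bullet> z i)\<bar> \<le> A * K"
    and score: "\<And>j. \<bar>\<Sum>i\<in>I. (y i - expit (a0 + b0 \<bullet> z i)) * z i $ j\<bar> \<le> A * K * \<tau>"
    and lam: "lam \<le> L * K * \<tau>"
    and curv: "\<And>\<alpha> \<beta>. m * K\<^sup>2 * (\<bar>\<alpha>\<bar> + \<tau> * l1_norm \<beta>)\<^sup>2 \<le> (\<Sum>i\<in>I. (\<alpha> + \<beta> \<bullet> z i)\<^sup>2)"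
    and near: "\<And>i. i \<in> I \<Longrightarrow> \<bar>b0 \<bullet> z i\<bar> \<le> 1 / 2" "\<And>i. i \<in> I \<Longrightarrow> norm (z i) \<le> 4 * \<tau>"
    and \<kappa>: "0 < \<kappa>" "\<And>s. \<bar>s - a0\<bar> \<le> 1 \<Longrightarrow> \<kappa> \<le> expit s * (1 - expit s)"
    and D: "8 * D \<le> K" "A + L < \<kappa> * m / 2 * D"
  shows "\<exists>ab. is_arg_max (penalized_loglik I y z lam) (\<lambda>_. True) ab"
    and "is_arg_max (penalized_loglik I y z lam) (\<lambda>_. True) (a, b) \<Longrightarrow> \<tau> * norm (b - b0) \<le> D / K"
proof -
  let ?G = "penalized_loglik I y z lam"
  define N where "N a b = \<bar>a - a0\<bar> + \<tau> * l1_norm (b - b0)" for a b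
  text \<open>On the sphere of radius \<open>D / K\<close> for \<open>N\<close> the objective is below its value at the center;
    by concavity the same holds outside.\<close>
  have boundary: "?G (a, b) < ?G (a0, b0)" if "N a b = D / K" for a b
  proof -
    have "\<bar>(a - a0) + (b - b0) \<bullet> z i\<bar> \<le> 1 / 2" if "i \<in> I" for i
    proof -
      have "\<bar>(b - b0) \<bullet> z i\<bar> \<le> norm (b - b0) * norm (z i)"
        by (rule Cauchy_Schwarz_ineq2)
      also have "\<dots> \<le> l1_norm (b - b0) * (4 * \<tau>)"
        by (intro mult_mono norm_le_l1_norm near that l1_norm_nonneg) auto
      also have "\<dots> = 4 * (\<tau> * l1_norm (b - b0))" by simp
      finally have "\<bar>(a - a0) + (b - b0) \<bullet> z i\<bar> \<le> 4 * N a b"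
        using abs_triangle_ineq[of "a - a0" "(b - b0) \<bullet> z i"] abs_ge_zero[of "a - a0"]
        unfolding N_def distrib_left by argo
      also have "4 * N a b \<le> 1 / 2"
        unfolding \<open>N a b = D / K\<close> using D(1) pos by (simp add: field_simps)
      finally show ?thesis .
    qed
    then have "?G (a, b) - ?G (a0, b0) \<le> (A + L) * K * N a b - \<kappa> * m / 2 * K\<^sup>2 * (N a b)\<^sup>2"
      by (intro penalized_loglik_increment[OF pos(1-3) score0 score lam curv near(1)] \<kappa>)
         (auto simp: N_def)
    \<comment> \<open>At \<open>N = D / K\<close> all powers of \<open>K\<close> cancel.\<close>
    also have "\<dots> = D * ((A + L) - \<kappa> * m / 2 * D)"
      unfolding that using pos by (simp add: power2_eq_square field_simps)
    also have "\<dots> < 0"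
      using D(2) pos(4) by (simp add: mult_pos_neg)
    finally show ?thesis by simp
  qed
  have outside: "?G (a, b) < ?G (a0, b0)" if *: "D / K < N a b" for a b
  proof -
    \<comment> \<open>The factor that pulls \<open>(a, b)\<close> back along its ray from the center
      onto the sphere.\<close>
    define t where "t = D / K / N a b"
    have DK: "0 < D / K" using pos by simp
    with * have N0: "0 < N a b" by linarith
    have t: "0 < t" "t \<le> 1"
      using DK N0 * unfolding t_def by (metis divide_pos_pos, metis divide_le_eq_1_pos less_imp_le)
    have "N (a0 + t * (a - a0)) (b0 + t *\<^sub>R (b - b0)) = t * N a b"
      using t by (simp add: N_def l1_norm_scaleR abs_mult distrib_left)
    also have "\<dots> = D / K" using N0 by (simp add: t_def)
    finally have "?G (a0 + t * (a - a0), b0 + t *\<^sub>R (b - b0)) < ?G (a0, b0)"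
      by (rule boundary)
    moreover have "(1 - t) * ?G (a0, b0) + t * ?G (a, b)
       \<le> ?G (a0 + t * (a - a0), b0 + t *\<^sub>R (b - b0))"
      using t pos by (intro penalized_loglik_concave) auto
    ultimately have "t * ?G (a, b) < t * ?G (a0, b0)"
      by (simp add: algebra_simps)
    then show ?thesis using t by simp
  qed
  \<comment> \<open>A compact box containing the \<open>N\<close>-ball of radius
    \<open>D / K\<close>; its second factor is exactly the asserted bound on
    \<open>b\<close>.\<close>
  let ?C = "cball a0 (D / K) \<times> cball b0 (D / K / \<tau>)"
  have inC: "(a, b) \<in> ?C" if "N a b \<le> D / K" for a b
  proof -
    have "\<tau> * norm (b - b0) \<le> \<tau> * l1_norm (b - b0)" "0 \<le> \<tau> * l1_norm (b - b0)"
      using pos norm_le_l1_norm[of "b - b0"] l1_norm_nonneg[of "b - b0"] by auto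
    then have "\<bar>a - a0\<bar> \<le> D / K" "\<tau> * norm (b - b0) \<le> D / K"
      using that unfolding N_def by linarith+
    then show ?thesis
      using pos by (simp add: dist_norm norm_minus_commute abs_minus_commute field_simps)
  qed
  have "compact ?C" by (intro compact_Times compact_cball)
  moreover have center: "(a0, b0) \<in> ?C"
    using pos by (simp add: less_imp_le)
  then have "?C \<noteq> {}" by blast
  moreover have "continuous_on ?C ?G"
    unfolding penalized_loglik_def case_prod_beta by (intro continuous_intros)
  ultimately obtain p where p: "p \<in> ?C" "\<And>q. q \<in> ?C \<Longrightarrow> ?G q \<le> ?G p"
    by (meson continuous_attains_sup)
  have "?G (a0, b0) \<le> ?G p"
    by (rule p(2)) (rule center)
  \<comment> \<open>A point outside the box has \<open>N > D / K\<close> and so lies below the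
    center, which in turn is below \<open>p\<close>.\<close>
  then have "?G q \<le> ?G p" for q
    using outside[of "fst q" "snd q"] inC[of "fst q" "snd q"] p(2)[of q] by force
  then show "\<exists>ab. is_arg_max ?G (\<lambda>_. True) ab"
    unfolding is_arg_max_def by (meson not_less)
  assume "is_arg_max ?G (\<lambda>_. True) (a, b)"
  then have "\<not> ?G (a, b) < ?G (a0, b0)" by (auto simp: is_arg_max_def)
  then have "(a, b) \<in> ?C" using outside[of a b] inC[of a b] by force
  then show "\<tau> * norm (b - b0) \<le> D / K"
    using pos by (simp add: dist_norm norm_minus_commute field_simps)
qed

section \<open>Curvature, bias and nearest neighbors\<close>

text \<open>For the largest coordinate \<open>\<beta>\<^sub>j\<close>, the sign of the anchor \<open>\<plusminus>(\<tau>/4) e\<^sub>j\<close> can be chosen such that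
  \<open>\<alpha>\<close> and \<open>\<beta> \<bullet> z\<close> do not cancel for \<open>z\<close> near the anchor.\<close>

lemma curvature_from_anchors:
  fixes z :: "nat \<Rightarrow> real ^ 'p" and m K :: real
  assumes "finite I" "0 < \<tau>" "0 \<le> m"
    and count: "\<And>j s. s \<in> {-1, 1} \<Longrightarrow>
      m * K\<^sup>2 \<le> card {i \<in> I. dist (z i) ((s * \<tau> / 4) *\<^sub>R axis j 1) < \<tau> / (8 * CARD('p))}"
  shows "m / (64 * (real CARD('p))\<^sup>2) * K\<^sup>2 * (\<bar>\<alpha>\<bar> + \<tau> * l1_norm \<beta>)\<^sup>2
    \<le> (\<Sum>i\<in>I. (\<alpha> + \<beta> \<bullet> z i)\<^sup>2)"
proof -
  define p where "p = real CARD('p)"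
  have p: "1 \<le> p" unfolding p_def by (simp add: Suc_le_eq)
  obtain j where j: "\<And>i. \<bar>\<beta> $ i\<bar> \<le> \<bar>\<beta> $ j\<bar>"
  proof -
    have "Max (range (\<lambda>i. \<bar>\<beta> $ i\<bar>)) \<in> range (\<lambda>i. \<bar>\<beta> $ i\<bar>)"
      by (intro Max_in) auto
    then obtain j where "Max (range (\<lambda>i. \<bar>\<beta> $ i\<bar>)) = \<bar>\<beta> $ j\<bar>" by blast
    then have "\<bar>\<beta> $ i\<bar> \<le> \<bar>\<beta> $ j\<bar>" for i
      using Max_ge[of "range (\<lambda>i. \<bar>\<beta> $ i\<bar>)" "\<bar>\<beta> $ i\<bar>"] by auto
    then show ?thesis by (rule that)
  qed
  have l1: "l1_norm \<beta> \<le> p * \<bar>\<beta> $ j\<bar>"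
    unfolding l1_norm_def p_def using sum_bounded_above[of UNIV "\<lambda>i. \<bar>\<beta> $ i\<bar>" "\<bar>\<beta> $ j\<bar>"] j by simp
  define s :: real where "s = (if 0 \<le> \<alpha> * \<beta> $ j then 1 else -1)"
  define c :: "real ^ 'p" where "c = (s * \<tau> / 4) *\<^sub>R axis j 1"
  define J where "J = {i \<in> I. dist (z i) c < \<tau> / (8 * p)}"
  \<comment> \<open>A lower bound for \<open>|\<alpha> + \<beta> \<bullet> z i|\<close> on
    \<open>J\<close>, obtained by bounding the largest coordinate of \<open>\<beta>\<close> below by
    \<open>l1_norm \<beta> / p\<close>. Its square produces the factor
    \<open>64 * p^2\<close>.\<close>
  define q where "q = (\<bar>\<alpha>\<bar> + \<tau> * l1_norm \<beta>) / (8 * p)"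
  have q0: "0 \<le> q"
    unfolding q_def using assms(2) p l1_norm_nonneg[of \<beta>] by auto
  have center: "\<bar>\<alpha> + \<beta> \<bullet> c\<bar> = \<bar>\<alpha>\<bar> + \<tau> / 4 * \<bar>\<beta> $ j\<bar>"
  proof -
    have bc: "\<beta> \<bullet> c = \<tau> / 4 * (s * \<beta> $ j)"
      by (simp add: c_def inner_axis)
    have "\<bar>\<alpha> + \<tau> / 4 * (s * \<beta> $ j)\<bar> = \<bar>\<alpha>\<bar> + \<bar>\<tau> / 4 * (s * \<beta> $ j)\<bar>"
    proof -
      have "0 \<le> \<alpha> * (s * \<beta> $ j)"
        by (auto simp: s_def)
      then have "0 \<le> \<alpha> * (\<tau> / 4 * (s * \<beta> $ j))"
        using assms(2) by (metis divide_nonneg_nonneg less_imp_le mult.left_commute mult_nonneg_nonneg zero_le_numeral)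
      then show ?thesis by (auto simp: zero_le_mult_iff)
    qed
    also have "\<bar>\<tau> / 4 * (s * \<beta> $ j)\<bar> = \<tau> / 4 * \<bar>\<beta> $ j\<bar>"
      using assms(2) by (simp add: abs_mult s_def)
    finally show ?thesis unfolding bc .
  qed
  have far: "q\<^sup>2 \<le> (\<alpha> + \<beta> \<bullet> z i)\<^sup>2" if "i \<in> J" for i
  proof -
    have "\<bar>\<beta> \<bullet> (z i - c)\<bar> \<le> norm \<beta> * norm (z i - c)"
      by (rule Cauchy_Schwarz_ineq2)
    \<comment> \<open>The radius \<open>\<tau> / (8 * p)\<close> absorbs the factor \<open>p\<close>
      in \<open>norm \<beta> \<le> p * |\<beta> $ j|\<close>; the deviation from the anchor then
      uses up only half of the gain \<open>\<tau> / 4 * |\<beta> $ j|\<close>.\<close>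
    also have "\<dots> \<le> (p * \<bar>\<beta> $ j\<bar>) * (\<tau> / (8 * p))"
      using that order_trans[OF norm_le_l1_norm l1] p
      by (intro mult_mono) (auto simp: J_def dist_norm)
    also have "\<dots> = \<tau> / 8 * \<bar>\<beta> $ j\<bar>" using p by simp
    finally have "\<bar>\<beta> \<bullet> (z i - c)\<bar> \<le> \<tau> / 8 * \<bar>\<beta> $ j\<bar>" .
    moreover have "\<alpha> + \<beta> \<bullet> z i = (\<alpha> + \<beta> \<bullet> c) + \<beta> \<bullet> (z i - c)"
      by (simp add: inner_diff_right)
    ultimately have "\<bar>\<alpha>\<bar> + \<tau> / 8 * \<bar>\<beta> $ j\<bar> \<le> \<bar>\<alpha> + \<beta> \<bullet> z i\<bar>"
      using center by linarith
    moreover have "q \<le> \<bar>\<alpha>\<bar> + \<tau> / 8 * \<bar>\<beta> $ j\<bar>"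
    proof -
      have "q = \<bar>\<alpha>\<bar> / (8 * p) + \<tau> / (8 * p) * l1_norm \<beta>"
        by (simp add: q_def add_divide_distrib)
      also have "\<tau> / (8 * p) * l1_norm \<beta> \<le> \<tau> / (8 * p) * (p * \<bar>\<beta> $ j\<bar>)"
        using assms(2) p l1 by (intro mult_left_mono) auto
      also have "\<tau> / (8 * p) * (p * \<bar>\<beta> $ j\<bar>) = \<tau> / 8 * \<bar>\<beta> $ j\<bar>"
        using p by simp
      also have "\<bar>\<alpha>\<bar> / (8 * p) \<le> \<bar>\<alpha>\<bar> / 1"
        using p by (intro divide_left_mono) auto
      finally show ?thesis by simp
    qed
    ultimately have "\<bar>q\<bar> \<le> \<bar>\<alpha> + \<beta> \<bullet> z i\<bar>" using q0 by linarith
    then show ?thesis by (rule abs_le_square_iff[THEN iffD1])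
  qed
  have "m * K\<^sup>2 \<le> card J"
    using count[of s j] unfolding J_def c_def p_def by (simp add: s_def)
  then have "m * K\<^sup>2 * q\<^sup>2 \<le> card J * q\<^sup>2"
    by (intro mult_right_mono) auto
  also have "\<dots> = (\<Sum>i\<in>J. q\<^sup>2)" by simp
  also have "\<dots> \<le> (\<Sum>i\<in>J. (\<alpha> + \<beta> \<bullet> z i)\<^sup>2)"
    by (rule sum_mono) (rule far)
  also have "\<dots> \<le> (\<Sum>i\<in>I. (\<alpha> + \<beta> \<bullet> z i)\<^sup>2)"
    by (rule sum_mono2) (auto simp: J_def assms)
  finally show ?thesis
    unfolding q_def p_def by (simp add: power_divide power_mult_distrib)
qed

text \<open>The gradient vanishes at \<open>x\<close> and is differentiable there, so it grows at
  most linearly in the distance to \<open>x\<close>; the mean value inequality supplies the second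
  factor of the distance.\<close>

lemma quadratic_remainder:
  fixes \<psi> :: "'a::euclidean_space \<Rightarrow> real"
  assumes "open U" "x \<in> U" and grad: "\<And>z. z \<in> U \<Longrightarrow> GDERIV \<psi> z :> G z"
    and G: "(G has_derivative G') (at x)" "G x = 0" and "\<psi> x = 0"
  obtains C d where "0 \<le> C" "0 < d" "\<And>z. dist z x < d \<Longrightarrow> \<bar>\<psi> z\<bar> \<le> C * (dist z x)\<^sup>2"
proof -
  obtain d0 where d0: "0 < d0" "ball x d0 \<subseteq> U"
    using assms(1,2) openE by blast
  obtain d1 where d1: "0 < d1"
    "\<And>y. norm (y - x) < d1 \<Longrightarrow> norm (G y - G x - G' (y - x)) \<le> 1 * norm (y - x)"
    using G(1) zero_less_one unfolding has_derivative_at_alt by blast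
  have bl: "bounded_linear G'" using G(1) by (rule has_derivative_bounded_linear)
  define C where "C = 1 + onorm G'"
  have C: "0 \<le> C" using onorm_pos_le[OF bl] by (simp add: C_def)
  have G_le: "norm (G y) \<le> C * norm (y - x)" if "norm (y - x) < d1" for y
  proof -
    have "norm (G y) \<le> norm (G y - G x - G' (y - x)) + norm (G' (y - x))"
      using norm_triangle_ineq[of "G y - G' (y - x)" "G' (y - x)"] G(2) by simp
    also have "\<dots> \<le> 1 * norm (y - x) + onorm G' * norm (y - x)"
      by (intro add_mono d1 that onorm bl)
    finally show ?thesis by (simp add: C_def algebra_simps)
  qed
  show ?thesis
  proof (rule that[of C "min d0 d1"])
    fix z assume z: "dist z x < min d0 d1"
    \<comment> \<open>The ball used has radius exactly \<open>dist z x\<close>, so the gradient is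
      bounded on it by \<open>C * dist z x\<close>.\<close>
    have "norm (\<psi> z - \<psi> x) \<le> C * dist z x * norm (z - x)"
    proof (rule differentiable_bound[of "cball x (dist z x)"])
      fix y assume y: "y \<in> cball x (dist z x)"
      then have yU: "y \<in> U" "norm (y - x) \<le> dist z x" "norm (y - x) < d1"
        using z d0(2) by (auto simp: dist_norm norm_minus_commute)
      show "(\<psi> has_derivative (\<lambda>h. h \<bullet> G y)) (at y within cball x (dist z x))"
        using grad[OF yU(1)] unfolding gderiv_def by (rule has_derivative_at_withinI)
      show "onorm (\<lambda>h. h \<bullet> G y) \<le> C * dist z x"
      proof (rule onorm_le)
        fix h
        have "norm (h \<bullet> G y) \<le> norm h * norm (G y)"
          unfolding real_norm_def by (rule Cauchy_Schwarz_ineq2)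
        also have "\<dots> \<le> norm h * (C * dist z x)"
          using G_le[OF yU(3)] mult_left_mono[OF yU(2) C] by (intro mult_left_mono) auto
        finally show "norm (h \<bullet> G y) \<le> C * dist z x * norm h" by (simp add: mult_ac)
      qed
    qed (auto simp: dist_commute)
    then show "\<bar>\<psi> z\<bar> \<le> C * (dist z x)\<^sup>2"
      using assms(6) by (simp add: power2_eq_square dist_norm mult.assoc)
  qed (use C d0 d1 in auto)
qed

text \<open>The logistic model with intercept \<open>logit (\<pi> x)\<close> and slope
  \<open>b0\<close> agrees with \<open>\<pi>\<close> at \<open>x\<close> to first order: by the
  chain rule \<open>b0\<close> is the gradient of \<open>\<pi>\<close> divided by
  \<open>\<pi> x * (1 - \<pi> x)\<close>, and differentiating \<open>expit\<close> multiplies by the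
  same variance. Only a quadratic remainder is left.\<close>

lemma expit_tangent_bias:
  fixes \<pi> :: "real ^ 'p \<Rightarrow> real"
  assumes "C2_at \<pi> x" "0 < \<pi> x" "\<pi> x < 1"
  defines "b0 \<equiv> gradient (\<lambda>z. logit (\<pi> z)) x"
  obtains C d where "0 \<le> C" "0 < d"
    "\<And>z. dist z x < d \<Longrightarrow> \<bar>\<pi> z - expit (logit (\<pi> x) + b0 \<bullet> (z - x))\<bar> \<le> C * (dist z x)\<^sup>2"
proof -
  obtain U g H where U: "open U" "x \<in> U" "\<And>z. z \<in> U \<Longrightarrow> GDERIV \<pi> z :> g z"
    "\<And>z. z \<in> U \<Longrightarrow> (g has_derivative (\<lambda>h. H z *v h)) (at z)"
    using assms(1) unfolding C2_at_def by blast
  have "(logit has_real_derivative 1 / (\<pi> x * (1 - \<pi> x))) (at (\<pi> x))"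
    unfolding logit_def[abs_def] using assms(2,3)
    by (auto intro!: derivative_eq_intros simp: divide_simps)
  from GDERIV_DERIV_compose[OF U(3)[OF U(2)] this]
  have b0: "b0 = (1 / (\<pi> x * (1 - \<pi> x))) *\<^sub>R g x"
    unfolding b0_def by (rule gradient_eqI)
  define e where "e z = expit (logit (\<pi> x) + b0 \<bullet> (z - x))" for z
  have ex: "e x = \<pi> x" using assms(2,3) by (simp add: e_def expit_logit)
  have e': "(e has_derivative (\<lambda>h. (b0 \<bullet> h) * (e z * (1 - e z)))) (at z)" for z
    unfolding e_def[abs_def]
    by (rule DERIV_compose_FDERIV[OF DERIV_expit]) (auto intro!: derivative_eq_intros)
  have grad: "GDERIV (\<lambda>z. \<pi> z - e z) z :> g z - (e z * (1 - e z)) *\<^sub>R b0" if "z \<in> U" for z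
    using U(3)[OF that] e'[of z] unfolding gderiv_def
    by (auto intro!: derivative_eq_intros simp: inner_diff_right inner_commute)
  \<comment> \<open>Only the existence of the derivative matters; the differentiation rules build
    the witness.\<close>
  have "\<exists>G'. ((\<lambda>z. g z - (e z * (1 - e z)) *\<^sub>R b0) has_derivative G') (at x)"
    by (rule exI) (rule derivative_intros U(4) U(2) e')+
  then obtain G' where G': "((\<lambda>z. g z - (e z * (1 - e z)) *\<^sub>R b0) has_derivative G') (at x)" ..
  have "g x - (e x * (1 - e x)) *\<^sub>R b0 = 0"
    using assms(2,3) by (simp add: ex b0)
  then obtain C d where "0 \<le> C" "0 < d" "\<And>z. dist z x < d \<Longrightarrow> \<bar>\<pi> z - e z\<bar> \<le> C * (dist z x)\<^sup>2"
    using ex quadratic_remainder[OF U(1,2) grad G'] by auto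
  then show ?thesis
    using that by (simp add: e_def)
qed

section \<open>Nearest neighbors and counts of points in balls\<close>

lemma finite_nearest_neighbors [simp]: "finite (nearest_neighbors xs n k x)"
  by (simp add: nearest_neighbors_def)

text \<open>Breaking ties by index makes the order total, so the rank \<open>card (before i)\<close>
  is injective, and neighbors are the indices of rank below \<open>k\<close>.\<close>

lemma card_nearest_neighbors_le: "card (nearest_neighbors xs n k x) \<le> k"
proof -
  define before where "before i = {j \<in> {1..n}. dist (xs j) x < dist (xs i) x \<or>
    (dist (xs j) x = dist (xs i) x \<and> j < i)}" for i
  have less: "card (before i) < card (before j)"
    if "i \<in> {1..n}" "dist (xs i) x < dist (xs j) x \<or> (dist (xs i) x = dist (xs j) x \<and> i < j)" for i j
  proof (rule psubset_card_mono)
    have "i \<in> before j" "i \<notin> before i" "before i \<subseteq> before j"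
      using that by (auto simp: before_def)
    then show "before i \<subset> before j" by blast
  qed (simp add: before_def)
  have "inj_on (\<lambda>i. card (before i)) {1..n}"
  proof (rule inj_onI)
    fix i j assume ij: "i \<in> {1..n}" "j \<in> {1..n}" "card (before i) = card (before j)"
    show "i = j"
      using less[of i j] less[of j i] ij by (metis less_irrefl linorder_neqE)
  qed
  then have "inj_on (\<lambda>i. card (before i)) (nearest_neighbors xs n k x)"
    by (rule inj_on_subset) (auto simp: nearest_neighbors_def)
  moreover have "(\<lambda>i. card (before i)) ` nearest_neighbors xs n k x \<subseteq> {..<k}"
    by (auto simp: nearest_neighbors_def before_def)
  ultimately show ?thesis
    using card_inj_on_le[of _ _ "{..<k}"] by force
qed

text \<open>A point outside the ball is preceded by every point inside it, so its rank is at least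
  \<open>k\<close>.\<close>

lemma nearest_neighbors_dist_less:
  assumes "i \<in> nearest_neighbors xs n k x" "k \<le> card {j \<in> {1..n}. dist (xs j) x < r}"
  shows "dist (xs i) x < r"
proof (rule ccontr)
  assume "\<not> dist (xs i) x < r"
  then have "card {j \<in> {1..n}. dist (xs j) x < r} \<le> card {j \<in> {1..n}. dist (xs j) x < dist (xs i) x \<or>
      (dist (xs j) x = dist (xs i) x \<and> j < i)}"
    by (intro card_mono) auto
  then show False
    using assms by (auto simp: nearest_neighbors_def)
qed

text \<open>All predecessors of a point in the ball lie in the ball, and the point is not its own
  predecessor. This strictness is why a count of at most \<open>k\<close> suffices.\<close>

lemma in_nearest_neighborsI:
  assumes "i \<in> {1..n}" "dist (xs i) x < r" "card {j \<in> {1..n}. dist (xs j) x < r} \<le> k"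
  shows "i \<in> nearest_neighbors xs n k x"
proof -
  have "card {j \<in> {1..n}. dist (xs j) x < dist (xs i) x \<or> (dist (xs j) x = dist (xs i) x \<and> j < i)}
      < card {j \<in> {1..n}. dist (xs j) x < r}"
    using assms by (intro psubset_card_mono) auto
  then show ?thesis
    using assms by (simp add: nearest_neighbors_def)
qed

section \<open>Second moments of sums of orthogonal variables\<close>

text \<open>Pythagoras in L2. Orthogonality replaces independence because the residuals weighted by
  the neighbor selection are dependent, yet still orthogonal.\<close>

lemma (in prob_space) second_moment_sum_orthogonal:
  fixes Z :: "'i \<Rightarrow> 'a \<Rightarrow> real" and B :: real
  assumes "finite I"
    and meas [measurable]: "\<And>i. i \<in> I \<Longrightarrow> Z i \<in> borel_measurable M"
    and bound: "\<And>i \<omega>. i \<in> I \<Longrightarrow> \<omega> \<in> space M \<Longrightarrow> \<bar>Z i \<omega>\<bar> \<le> B"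
    and orth: "\<And>i j. i \<in> I \<Longrightarrow> j \<in> I \<Longrightarrow> i \<noteq> j \<Longrightarrow> expectation (\<lambda>\<omega>. Z i \<omega> * Z j \<omega>) = 0"
  shows "integrable M (\<lambda>\<omega>. (\<Sum>i\<in>I. Z i \<omega>)\<^sup>2)"
    and "expectation (\<lambda>\<omega>. (\<Sum>i\<in>I. Z i \<omega>)\<^sup>2) = (\<Sum>i\<in>I. expectation (\<lambda>\<omega>. (Z i \<omega>)\<^sup>2))"
proof -
  have int: "integrable M (\<lambda>\<omega>. Z i \<omega> * Z j \<omega>)" if "i \<in> I" "j \<in> I" for i j
  proof (rule integrable_const_bound[where B = "B * B"])
    show "AE \<omega> in M. norm (Z i \<omega> * Z j \<omega>) \<le> B * B"
    proof (rule AE_I2)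
      fix \<omega> assume "\<omega> \<in> space M"
      then have "\<bar>Z i \<omega>\<bar> \<le> B" "\<bar>Z j \<omega>\<bar> \<le> B" using bound that by auto
      then show "norm (Z i \<omega> * Z j \<omega>) \<le> B * B"
        unfolding real_norm_def abs_mult by (intro mult_mono) auto
    qed
  qed (use that in measurable)
  have sq: "(\<lambda>\<omega>. (\<Sum>i\<in>I. Z i \<omega>)\<^sup>2) = (\<lambda>\<omega>. \<Sum>i\<in>I. \<Sum>j\<in>I. Z i \<omega> * Z j \<omega>)"
    by (simp add: power2_eq_square sum_product)
  show "integrable M (\<lambda>\<omega>. (\<Sum>i\<in>I. Z i \<omega>)\<^sup>2)"
    unfolding sq by (intro Bochner_Integration.integrable_sum int)
  have "expectation (\<lambda>\<omega>. (\<Sum>i\<in>I. Z i \<omega>)\<^sup>2)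
      = (\<Sum>i\<in>I. \<Sum>j\<in>I. expectation (\<lambda>\<omega>. Z i \<omega> * Z j \<omega>))"
    unfolding sq by (simp add: Bochner_Integration.integral_sum int Bochner_Integration.integrable_sum)
  also have "\<dots> = (\<Sum>i\<in>I. \<Sum>j\<in>I. if i = j then expectation (\<lambda>\<omega>. (Z i \<omega>)\<^sup>2) else 0)"
    by (intro sum.cong refl) (auto simp: orth power2_eq_square)
  also have "\<dots> = (\<Sum>i\<in>I. expectation (\<lambda>\<omega>. (Z i \<omega>)\<^sup>2))"
    using assms(1) by simp
  finally show "expectation (\<lambda>\<omega>. (\<Sum>i\<in>I. Z i \<omega>)\<^sup>2) = (\<Sum>i\<in>I. expectation (\<lambda>\<omega>. (Z i \<omega>)\<^sup>2))" .
qed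

text \<open>The variance of each centered indicator is at most \<open>q\<close>. Keeping this factor
  matters: with \<open>card I * q\<close> of order \<open>k\<close>, deviations of order
  \<open>k\<close> have probability of order \<open>1 / k\<close>.\<close>

lemma (in prob_space) count_Chebyshev:
  fixes q t :: real
  assumes indep: "indep_vars (\<lambda>_. N) W I" and "finite I" and A [measurable]: "A \<in> sets N"
    and q: "\<And>i. i \<in> I \<Longrightarrow> prob {\<omega> \<in> space M. W i \<omega> \<in> A} = q" and "0 < t"
  shows "prob {\<omega> \<in> space M. t \<le> \<bar>real (card {i \<in> I. W i \<omega> \<in> A}) - card I * q\<bar>} \<le> card I * q / t\<^sup>2"
proof -
  have W [measurable]: "W i \<in> measurable M N" if "i \<in> I" for i
    using indep that unfolding indep_vars_def2 by simp
  define Z where "Z i \<omega> = indicator A (W i \<omega>) - q" for i \<omega>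
  have ind: "(\<lambda>\<omega>. indicator A (W i \<omega>) :: real) \<in> borel_measurable M" if "i \<in> I" for i
    by (rule measurable_compose[OF W[OF that] borel_measurable_indicator[OF A]])
  have Z [measurable]: "Z i \<in> borel_measurable M" if "i \<in> I" for i
    unfolding Z_def[abs_def] using ind[OF that] by simp
  have q01: "0 \<le> q" "q \<le> 1" if "i \<in> I" for i
    using q[OF that] by (metis measure_nonneg, metis prob_le_1)
  have bound: "\<bar>Z i \<omega>\<bar> \<le> 1" if "i \<in> I" for i \<omega>
    using q01[OF that] by (auto simp: Z_def indicator_def)
  have int_ind: "integrable M (\<lambda>\<omega>. indicator A (W i \<omega>) :: real)" if "i \<in> I" for i
    by (intro integrable_const_bound[where B = 1] ind that) (auto simp: indicator_def)
  have E_ind: "expectation (\<lambda>\<omega>. indicator A (W i \<omega>)) = q" if "i \<in> I" for i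
  proof -
    have "expectation (\<lambda>\<omega>. indicator A (W i \<omega>))
        = expectation (indicator {\<omega> \<in> space M. W i \<omega> \<in> A})"
      by (rule Bochner_Integration.integral_cong) (auto simp: indicator_def)
    also have "\<dots> = q"
      using q[OF that] W[OF that] by simp
    finally show ?thesis .
  qed
  have int: "integrable M (Z i)" if "i \<in> I" for i
    unfolding Z_def using int_ind[OF that] by simp
  have mean: "expectation (Z i) = 0" if "i \<in> I" for i
    unfolding Z_def using int_ind[OF that] E_ind[OF that] by (simp add: prob_space)
  have orth: "expectation (\<lambda>\<omega>. Z i \<omega> * Z j \<omega>) = 0" if "i \<in> I" "j \<in> I" "i \<noteq> j" for i j
  proof -
    have "indep_vars (\<lambda>_. borel) Z I"
      unfolding Z_def by (rule indep_vars_compose2[OF indep]) simp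
    then have "indep_vars (\<lambda>_. borel) Z {i, j}"
      by (rule indep_vars_subset) (use that in auto)
    then have "expectation (\<lambda>\<omega>. \<Prod>l\<in>{i, j}. Z l \<omega>) = (\<Prod>l\<in>{i, j}. expectation (Z l))"
      by (intro indep_vars_lebesgue_integral) (use that int in auto)
    then show ?thesis using that mean by simp
  qed
  have second: "expectation (\<lambda>\<omega>. (Z i \<omega>)\<^sup>2) \<le> q" if "i \<in> I" for i
  proof -
    have "(Z i \<omega>)\<^sup>2 = (1 - 2 * q) * indicator A (W i \<omega>) + q\<^sup>2" for \<omega>
      by (simp add: Z_def indicator_def power2_eq_square algebra_simps)
    then have "expectation (\<lambda>\<omega>. (Z i \<omega>)\<^sup>2) = (1 - 2 * q) * q + q\<^sup>2"
      using int_ind[OF that] E_ind[OF that] by (simp add: prob_space)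
    also have "\<dots> \<le> q"
      using q01[OF that] by (simp add: power2_eq_square algebra_simps)
    finally show ?thesis .
  qed
  have sum_Z: "(\<Sum>i\<in>I. Z i \<omega>) = real (card {i \<in> I. W i \<omega> \<in> A}) - card I * q" for \<omega>
  proof -
    have "(\<Sum>i\<in>I. indicator A (W i \<omega>) :: real) = (\<Sum>i\<in>I. if W i \<omega> \<in> A then 1 else 0)"
      by (rule sum.cong) (auto simp: indicator_def)
    also have "\<dots> = card {i \<in> I. W i \<omega> \<in> A}"
      using assms(2) by (simp add: sum.If_cases Int_def)
    finally show ?thesis
      by (simp add: Z_def sum_subtractf)
  qed
  note ortho = second_moment_sum_orthogonal[of I Z 1, OF assms(2) Z bound orth]
  have "prob {\<omega> \<in> space M. t \<le> \<bar>\<Sum>i\<in>I. Z i \<omega>\<bar>} \<le> expectation (\<lambda>\<omega>. (\<Sum>i\<in>I. Z i \<omega>)\<^sup>2) / t\<^sup>2"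
    using ortho(1) \<open>0 < t\<close> by (intro second_moment_method) auto
  also have "expectation (\<lambda>\<omega>. (\<Sum>i\<in>I. Z i \<omega>)\<^sup>2) = (\<Sum>i\<in>I. expectation (\<lambda>\<omega>. (Z i \<omega>)\<^sup>2))"
    by (rule ortho(2)) auto
  also have "\<dots> / t\<^sup>2 \<le> card I * q / t\<^sup>2"
    using sum_bounded_above[of I "\<lambda>i. expectation (\<lambda>\<omega>. (Z i \<omega>)\<^sup>2)" q] second
    by (intro divide_right_mono) auto
  finally show ?thesis unfolding sum_Z .
qed

section \<open>Orthogonality of residuals given the covariates\<close>

text \<open>The indicator replaces the response \<open>y \<in> {0, 1}\<close> so that the residual is bounded on all of \<open>\<real>\<close>.\<close>

definition residual :: "('b \<Rightarrow> real) \<Rightarrow> real \<times> 'b \<Rightarrow> real" where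
  "residual r w = indicator {1} (fst w) - r (snd w)"

lemma residual_measurable [measurable]:
  fixes r :: "'b::second_countable_topology \<Rightarrow> real"
  assumes [measurable]: "r \<in> borel_measurable borel"
  shows "residual r \<in> borel_measurable (borel \<Otimes>\<^sub>M borel)"
  unfolding residual_def[abs_def] by measurable

text \<open>The defining property of the conditional expectation given \<open>X\<close>, tested
  against the bounded function \<open>g (X \<omega>)\<close>.\<close>

lemma (in prob_space) residual_orthogonal:
  fixes X :: "'a \<Rightarrow> real ^ 'p" and B :: real
  assumes [measurable]: "Y \<in> borel_measurable M" "X \<in> borel_measurable M"
    and reg: "is_regression_function M Y X r"
    and g [measurable]: "g \<in> borel_measurable borel" and g_bound: "\<And>z. \<bar>g z\<bar> \<le> B"
  shows "expectation (\<lambda>\<omega>. residual r (Y \<omega>, X \<omega>) * g (X \<omega>)) = 0"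
proof -
  define F where "F = vimage_algebra (space M) X borel"
  have r: "r \<in> borel_measurable borel" "\<And>z. 0 \<le> r z \<and> r z \<le> 1"
    and AE_r: "AE \<omega> in M. real_cond_exp M F (indicator {\<omega> \<in> space M. Y \<omega> = 1}) \<omega> = r (X \<omega>)"
    using reg by (auto simp: is_regression_function_def F_def)
  note [measurable] = r(1)
  have "subalgebra M F"
    unfolding F_def subalgebra_def using assms(2) by (simp add: sets_vimage_algebra2 measurable_sets subset_eq)
      (auto simp: sets_vimage_algebra2 measurable_sets)
  then interpret finite_measure_subalgebra M F
    by unfold_locales
  have gF [measurable]: "(\<lambda>\<omega>. g (X \<omega>)) \<in> borel_measurable F"
    unfolding F_def by (rule measurable_compose[OF measurable_vimage_algebra1 g]) auto
  have ind [measurable]: "{\<omega> \<in> space M. Y \<omega> = 1} \<in> sets M" by measurable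
  have int: "integrable M (\<lambda>\<omega>. g (X \<omega>) * indicator {\<omega> \<in> space M. Y \<omega> = 1} \<omega>)"
    using order_trans[OF abs_ge_zero g_bound] g_bound
    by (intro integrable_const_bound[where B = B]) (auto simp: indicator_def)
  have int': "integrable M (\<lambda>\<omega>. r (X \<omega>) * g (X \<omega>))"
  proof (rule integrable_const_bound[where B = "1 * B"])
    show "AE \<omega> in M. norm (r (X \<omega>) * g (X \<omega>)) \<le> 1 * B"
      unfolding real_norm_def abs_mult using r(2) g_bound by (intro AE_I2 mult_mono) auto
  qed measurable
  have "expectation (\<lambda>\<omega>. r (X \<omega>) * g (X \<omega>))
      = expectation (\<lambda>\<omega>. g (X \<omega>) * real_cond_exp M F (indicator {\<omega> \<in> space M. Y \<omega> = 1}) \<omega>)"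
    using AE_r by (intro integral_cong_AE) auto
  also have "\<dots> = expectation (\<lambda>\<omega>. g (X \<omega>) * indicator {\<omega> \<in> space M. Y \<omega> = 1} \<omega>)"
    by (rule real_cond_exp_intg[OF int]) auto
  finally have eq: "expectation (\<lambda>\<omega>. r (X \<omega>) * g (X \<omega>))
      = expectation (\<lambda>\<omega>. g (X \<omega>) * indicator {\<omega> \<in> space M. Y \<omega> = 1} \<omega>)" .
  have "expectation (\<lambda>\<omega>. residual r (Y \<omega>, X \<omega>) * g (X \<omega>))
      = expectation (\<lambda>\<omega>. g (X \<omega>) * indicator {\<omega> \<in> space M. Y \<omega> = 1} \<omega> - r (X \<omega>) * g (X \<omega>))"
    by (rule Bochner_Integration.integral_cong) (auto simp: residual_def indicator_def algebra_simps)
  also have "\<dots> = 0"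
    using int int' eq by simp
  finally show ?thesis .
qed

lemma residual_bound:
  assumes "\<And>z. 0 \<le> r z \<and> r z \<le> 1"
  shows "\<bar>residual r w\<bar> \<le> 1"
  using assms[of "snd w"] by (auto simp: residual_def indicator_def)

text \<open>The weight \<open>H\<close> sees the \<open>i\<close>-th pair only through its covariate, so that integrating this pair
  first gives zero.\<close>

lemma residual_orthogonal_PiM:
  fixes r :: "real ^ 'p \<Rightarrow> real" and B :: real
  assumes D: "prob_space D" and sets_D [measurable_cong]: "sets D = sets (borel \<Otimes>\<^sub>M borel)"
    and r: "r \<in> borel_measurable borel" "\<And>z. 0 \<le> r z \<and> r z \<le> 1"
    and orth: "\<And>g (B::real). g \<in> borel_measurable borel \<Longrightarrow> (\<And>z. \<bar>g z\<bar> \<le> B) \<Longrightarrow>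
       (\<integral>w. residual r w * g (snd w) \<partial>D) = 0"
    and I: "finite I" "i \<in> I"
    and H [measurable]: "H \<in> borel_measurable (Pi\<^sub>M I (\<lambda>_. borel \<Otimes>\<^sub>M borel))"
    and H_bound: "\<And>w. \<bar>H w\<bar> \<le> B"
    and H_inv: "\<And>w y y' v. H (w(i := (y, v))) = H (w(i := (y', v)))"
  shows "(\<integral>w. residual r (w i) * H w \<partial>Pi\<^sub>M I (\<lambda>_. D)) = 0"
proof -
  interpret D: prob_space D by (rule D)
  interpret product_sigma_finite "\<lambda>_ :: 'a. D" by unfold_locales
  interpret P: prob_space "Pi\<^sub>M I (\<lambda>_. D)" by (rule prob_space_PiM) (rule D)
  note [measurable] = r(1)
  have B: "0 \<le> B" using H_bound[of undefined] by linarith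
  have setsP [measurable_cong]: "sets (Pi\<^sub>M I (\<lambda>_. D)) = sets (Pi\<^sub>M I (\<lambda>_. borel \<Otimes>\<^sub>M borel))"
    by (intro sets_PiM_cong refl sets_D)
  have HP: "H \<in> borel_measurable (Pi\<^sub>M I (\<lambda>_. D))"
    using H by (simp add: measurable_cong_sets[OF setsP refl])
  define J where "J = I - {i}"
  have IJ: "I = insert i J" "finite J" "i \<notin> J" using I by (auto simp: J_def)
  have [measurable]: "(\<lambda>w. w i) \<in> measurable (Pi\<^sub>M I (\<lambda>_. D)) D"
    using I(2) by measurable
  have int: "integrable (Pi\<^sub>M (insert i J) (\<lambda>_. D)) (\<lambda>w. residual r (w i) * H w)"
    unfolding IJ(1)[symmetric]
  proof (rule P.integrable_const_bound[where B = "1 * B"])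
    show "AE w in Pi\<^sub>M I (\<lambda>_. D). norm (residual r (w i) * H w) \<le> 1 * B"
      unfolding real_norm_def abs_mult
      by (intro AE_I2 mult_mono residual_bound r H_bound) auto
    have "residual r \<in> borel_measurable D"
      using residual_measurable[OF r(1)] by (simp add: measurable_cong_sets[OF sets_D refl])
    then have "(\<lambda>w. residual r (w i)) \<in> borel_measurable (Pi\<^sub>M I (\<lambda>_. D))"
      by measurable
    then show "(\<lambda>w. residual r (w i) * H w) \<in> borel_measurable (Pi\<^sub>M I (\<lambda>_. D))"
      using HP by measurable
  qed
  \<comment> \<open>Fubini with coordinate \<open>i\<close> innermost and the remaining coordinates
    frozen.\<close>
  have "(\<integral>w. residual r (w i) * H w \<partial>Pi\<^sub>M I (\<lambda>_. D))
      = (\<integral>u. (\<integral>y. residual r ((u(i := y)) i) * H (u(i := y)) \<partial>D) \<partial>Pi\<^sub>M J (\<lambda>_. D))"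
    unfolding IJ(1) by (rule product_integral_insert[OF IJ(2,3) int])
  also have "\<dots> = (\<integral>u. 0 \<partial>Pi\<^sub>M J (\<lambda>_. D))"
  proof (rule Bochner_Integration.integral_cong[OF refl])
    fix u assume u: "u \<in> space (Pi\<^sub>M J (\<lambda>_. D))"
    \<comment> \<open>The response of the \<open>i\<close>-th pair is set to 0; by
      \<open>H_inv\<close> any other value gives the same function of the covariate.\<close>
    define g where "g v = H (u(i := (0, v)))" for v
    have "(\<lambda>v. u(i := (0, v))) \<in> measurable borel (Pi\<^sub>M (insert i J) (\<lambda>_. borel \<Otimes>\<^sub>M borel))"
    proof (rule measurable_fun_upd[where J = J])
      show "(\<lambda>v. u) \<in> measurable borel (Pi\<^sub>M J (\<lambda>_. borel \<Otimes>\<^sub>M borel))"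
        using u by (intro measurable_const) (simp add: space_PiM sets_eq_imp_space_eq[OF sets_D])
    qed auto
    then have "g \<in> borel_measurable borel"
      unfolding g_def using H by (auto simp: IJ(1)[symmetric] intro: measurable_compose)
    then have "(\<integral>y. residual r y * g (snd y) \<partial>D) = 0"
      by (rule orth[where B = B]) (simp add: g_def H_bound)
    moreover have "g (snd y) = H (u(i := y))" for y
      unfolding g_def using H_inv[of u 0 "snd y" "fst y"] by simp
    ultimately show "(\<integral>y. residual r ((u(i := y)) i) * H (u(i := y)) \<partial>D) = 0"
      by simp
  qed
  finally show ?thesis by simp
qed

section \<open>Second moment of the noise over the nearest neighbors\<close>

lemma nearest_neighbors_cong:
  "(\<And>i. i \<in> {1..n} \<Longrightarrow> xs i = xs' i) \<Longrightarrow> nearest_neighbors xs n k x = nearest_neighbors xs' n k x"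
  unfolding nearest_neighbors_def
  by (intro Collect_cong conj_cong refl arg_cong2[where f = "(<)"] arg_cong[where f = card]) auto

lemma in_nearest_neighbors_measurable:
  fixes xs :: "'w \<Rightarrow> nat \<Rightarrow> real ^ 'p"
  assumes [measurable]: "\<And>j. j \<in> {1..n} \<Longrightarrow> (\<lambda>\<omega>. xs \<omega> j) \<in> borel_measurable N"
  shows "Measurable.pred N (\<lambda>\<omega>. i \<in> nearest_neighbors (xs \<omega>) n k x)"
proof (cases "i \<in> {1..n}")
  case True
  define b where "b \<omega> j \<longleftrightarrow> dist (xs \<omega> j) x < dist (xs \<omega> i) x \<or>
    (dist (xs \<omega> j) x = dist (xs \<omega> i) x \<and> j < i)" for \<omega> j
  have b: "Measurable.pred N (\<lambda>\<omega>. b \<omega> j)" if "j \<in> {1..n}" for j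
  proof -
    note [measurable] = assms[OF that] assms[OF True]
    show ?thesis unfolding b_def by measurable
  qed
  \<comment> \<open>The rank as a finite sum of indicators, which reduces measurability of a
    cardinality to that of each comparison.\<close>
  have "i \<in> nearest_neighbors (xs \<omega>) n k x \<longleftrightarrow> (\<Sum>j\<in>{1..n}. if b \<omega> j then 1 else 0 :: real) < real k"
    for \<omega>
    using True by (simp add: nearest_neighbors_def b_def sum.If_cases Int_def)
  moreover have "Measurable.pred N (\<lambda>\<omega>. (\<Sum>j\<in>{1..n}. if b \<omega> j then 1 else 0 :: real) < real k)"
  proof -
    have "(\<lambda>\<omega>. \<Sum>j\<in>{1..n}. if b \<omega> j then 1 else 0 :: real) \<in> borel_measurable N"
      by (intro borel_measurable_sum measurable_If) (use b in auto)
    then show ?thesis by measurable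
  qed
  ultimately show ?thesis by simp
qed (simp add: nearest_neighbors_def)

text \<open>Neighbor selection depends on the covariates alone, so the sum over neighbors becomes a
  sum over \<open>{1..n}\<close> of residuals with covariate-dependent weights. These terms are
  orthogonal, and at most \<open>k\<close> of them are nonzero at each outcome: hence
  \<open>k\<close> and not \<open>n\<close> in the bound.\<close>

lemma (in prob_space) score_second_moment:
  fixes Xs :: "nat \<Rightarrow> 'a \<Rightarrow> real ^ 'p" and X :: "'a \<Rightarrow> real ^ 'p" and n k :: nat and x and B :: real
  assumes YX: "Y \<in> borel_measurable M" "X \<in> borel_measurable M"
    and copies: "independent_copies M Ys Xs Y X"
    and reg: "is_regression_function M Y X r"
    and \<phi> [measurable]: "\<phi> \<in> borel_measurable borel" and \<phi>_bound: "\<And>z. \<bar>\<phi> z\<bar> \<le> B"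
  defines "S \<equiv> \<lambda>\<omega>. \<Sum>i\<in>nearest_neighbors (\<lambda>i. Xs i \<omega>) n k x. residual r (Ys i \<omega>, Xs i \<omega>) * \<phi> (Xs i \<omega>)"
  shows "S \<in> borel_measurable M"
    and "integrable M (\<lambda>\<omega>. (S \<omega>)\<^sup>2)" and "expectation (\<lambda>\<omega>. (S \<omega>)\<^sup>2) \<le> k * B\<^sup>2"
proof -
  let ?N = "borel \<Otimes>\<^sub>M borel :: (real \<times> (real ^ 'p)) measure"
  let ?P = "Pi\<^sub>M {1..n} (\<lambda>_. ?N)"
  define D where "D = distr M ?N (\<lambda>\<omega>. (Y \<omega>, X \<omega>))"
  define W where "W i \<omega> = (Ys i \<omega>, Xs i \<omega>)" for i \<omega>
  note [measurable] = YX
  have r: "r \<in> borel_measurable borel" "\<And>z. 0 \<le> r z \<and> r z \<le> 1"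
    using reg by (auto simp: is_regression_function_def)
  note [measurable] = r(1)
  have indep: "indep_vars (\<lambda>_. ?N) W {1..}" and distr_W: "\<And>i. i \<ge> 1 \<Longrightarrow> distr M ?N (W i) = D"
    using copies unfolding independent_copies_def D_def W_def by auto
  have W: "W i \<in> measurable M ?N" if "i \<in> {1..n}" for i
    using indep that unfolding indep_vars_def2 by simp
  have D: "prob_space D"
    unfolding D_def by (rule prob_space_distr) measurable
  have sets_D: "sets D = sets ?N" by (simp add: D_def)
  have orth_D: "(\<integral>w. residual r w * g (snd w) \<partial>D) = 0"
    if [measurable]: "g \<in> borel_measurable borel" and "\<And>z. \<bar>g z\<bar> \<le> C" for g and C :: real
    unfolding D_def using residual_orthogonal[OF YX reg that]
    by (subst integral_distr) auto
  have B: "0 \<le> B" using \<phi>_bound[of undefined] by linarith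
  define nn where "nn w i \<longleftrightarrow> i \<in> nearest_neighbors (\<lambda>j. snd (w j)) n k x"
    for w :: "nat \<Rightarrow> real \<times> (real ^ 'p)" and i
  define h where "h w i = \<phi> (snd (w i)) * of_bool (nn w i)"
    for w :: "nat \<Rightarrow> real \<times> (real ^ 'p)" and i
  have h_bound: "\<bar>h w i\<bar> \<le> B" for w i
    using \<phi>_bound B by (simp add: h_def)
  have h_inv: "h (w(i := (y, v))) j = h (w(i := (y', v))) j" for w i j y y' v
  proof -
    have "(\<lambda>l. snd ((w(i := (y, v))) l)) = (\<lambda>l. snd ((w(i := (y', v))) l))" by auto
    then show ?thesis by (simp add: h_def nn_def)
  qed
  have h_meas: "(\<lambda>w. h w i) \<in> borel_measurable ?P" if "i \<in> {1..n}" for i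
  proof -
    have "Measurable.pred ?P (\<lambda>w. nn w i)"
      unfolding nn_def by (rule in_nearest_neighbors_measurable) measurable
    then show ?thesis
      unfolding h_def of_bool_def using that by measurable
  qed
  have res_meas: "(\<lambda>w. residual r (w i)) \<in> borel_measurable ?P" if "i \<in> {1..n}" for i
    using that by measurable
  \<comment> \<open>The sample as a point of the finite product space. Restricting to
    \<open>{1..n}\<close> leaves the neighbor set unchanged, since the latter inspects only these
    indices.\<close>
  define V where "V \<omega> = (\<lambda>i\<in>{1..n}. W i \<omega>)" for \<omega>
  have V: "V \<in> measurable M ?P"
    unfolding V_def using W by measurable
  have V_at: "V \<omega> i = (Ys i \<omega>, Xs i \<omega>)" if "i \<in> {1..n}" for i \<omega>
    using that by (simp add: V_def W_def)
  have h_V: "h (V \<omega>) i = \<phi> (Xs i \<omega>) * of_bool (i \<in> nearest_neighbors (\<lambda>i. Xs i \<omega>) n k x)"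
    if "i \<in> {1..n}" for i \<omega>
  proof -
    have "nearest_neighbors (\<lambda>j. snd (V \<omega> j)) n k x = nearest_neighbors (\<lambda>i. Xs i \<omega>) n k x"
      by (rule nearest_neighbors_cong) (simp add: V_def W_def)
    then show ?thesis using that by (simp add: h_def nn_def V_def W_def)
  qed
  define Z where "Z i \<omega> = residual r (V \<omega> i) * h (V \<omega>) i" for i \<omega>
  have Z_meas: "Z i \<in> borel_measurable M" if "i \<in> {1..n}" for i
    unfolding Z_def using h_meas[OF that] res_meas[OF that] V
    by (intro borel_measurable_times) (auto intro: measurable_compose[OF V])
  have Z_bound: "\<bar>Z i \<omega>\<bar> \<le> B" for i \<omega>
    unfolding Z_def abs_mult
    using mult_mono[OF residual_bound[OF r(2)] h_bound] B by fastforce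
  have S_eq: "S \<omega> = (\<Sum>i\<in>{1..n}. Z i \<omega>)" for \<omega>
  proof -
    have "S \<omega> = (\<Sum>i\<in>{1..n}. if i \<in> nearest_neighbors (\<lambda>i. Xs i \<omega>) n k x
        then residual r (Ys i \<omega>, Xs i \<omega>) * \<phi> (Xs i \<omega>) else 0)"
      unfolding S_def by (intro sum.mono_neutral_cong_left) (auto simp: nearest_neighbors_def)
    also have "\<dots> = (\<Sum>i\<in>{1..n}. Z i \<omega>)"
      by (intro sum.cong refl) (simp add: Z_def h_V V_at)
    finally show ?thesis .
  qed
  have orth: "expectation (\<lambda>\<omega>. Z i \<omega> * Z j \<omega>) = 0"
    if ij: "i \<in> {1..n}" "j \<in> {1..n}" "i \<noteq> j" for i j
  proof -
    \<comment> \<open>Everything in the product except the \<open>i\<close>-th residual. As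
      \<open>j\<close> differs from \<open>i\<close>, it depends on the \<open>i\<close>-th pair
      only through the covariate.\<close>
    define H where "H w = h w i * residual r (w j) * h w j" for w
    have H: "H \<in> borel_measurable ?P"
      unfolding H_def by (intro borel_measurable_times h_meas res_meas ij)
    have ne: "{1..n} \<noteq> {}" using ij by auto
    \<comment> \<open>Independence and equality of laws turn the joint law of the sample into a
      power of \<open>D\<close>.\<close>
    have "distr M ?P V = Pi\<^sub>M {1..n} (\<lambda>i. distr M ?N (W i))"
      unfolding V_def
      by (subst indep_vars_iff_distr_eq_PiM'[OF ne, symmetric])
         (use W in \<open>auto intro: indep_vars_subset[OF indep]\<close>)
    also have "\<dots> = Pi\<^sub>M {1..n} (\<lambda>_. D)"
      by (rule PiM_cong) (auto simp: distr_W)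
    finally have distr_V: "distr M ?P V = Pi\<^sub>M {1..n} (\<lambda>_. D)" .
    have "expectation (\<lambda>\<omega>. Z i \<omega> * Z j \<omega>) = expectation (\<lambda>\<omega>. residual r (V \<omega> i) * H (V \<omega>))"
      by (simp add: Z_def H_def mult_ac)
    also have "\<dots> = (\<integral>w. residual r (w i) * H w \<partial>distr M ?P V)"
      by (rule integral_distr[symmetric, OF V]) (intro borel_measurable_times H res_meas ij)
    also have "\<dots> = 0"
      unfolding distr_V
    proof (rule residual_orthogonal_PiM[OF D sets_D r orth_D _ ij(1) H])
      show "\<bar>H w\<bar> \<le> B * 1 * B" for w
        unfolding H_def abs_mult
        by (intro mult_mono h_bound residual_bound r) (use B in auto)
      show "H (w(i := (y, v))) = H (w(i := (y', v)))" for w y y' v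
        unfolding H_def using h_inv[of w i y v] ij(3) by (simp cong: h_inv)
    qed auto
    finally show ?thesis .
  qed
  note ortho = second_moment_sum_orthogonal[of "{1..n}" Z B, OF _ Z_meas Z_bound orth]
  show "S \<in> borel_measurable M"
    unfolding S_eq[abs_def] by (intro borel_measurable_sum Z_meas)
  show "integrable M (\<lambda>\<omega>. (S \<omega>)\<^sup>2)"
    unfolding S_eq by (rule ortho(1)) auto
  have Z_sq: "(Z i \<omega>)\<^sup>2 \<le> B\<^sup>2 * of_bool (i \<in> nearest_neighbors (\<lambda>i. Xs i \<omega>) n k x)"
    if "i \<in> {1..n}" for i \<omega>
  proof (cases "i \<in> nearest_neighbors (\<lambda>i. Xs i \<omega>) n k x")
    case True
    then show ?thesis
      using Z_bound[of i \<omega>] B by (simp add: abs_le_square_iff[symmetric])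
  qed (simp add: Z_def h_V[OF that])
  have "expectation (\<lambda>\<omega>. (S \<omega>)\<^sup>2) = (\<Sum>i\<in>{1..n}. expectation (\<lambda>\<omega>. (Z i \<omega>)\<^sup>2))"
    unfolding S_eq by (rule ortho(2)) auto
  also have "\<dots> = expectation (\<lambda>\<omega>. \<Sum>i\<in>{1..n}. (Z i \<omega>)\<^sup>2)"
  proof (rule Bochner_Integration.integral_sum[symmetric])
    fix i assume i: "i \<in> {1..n}"
    show "integrable M (\<lambda>\<omega>. (Z i \<omega>)\<^sup>2)"
      using Z_bound B Z_meas[OF i]
      by (intro integrable_const_bound[where B = "B\<^sup>2"]) (auto simp: abs_le_square_iff[symmetric])
  qed
  also have "\<dots> \<le> expectation (\<lambda>_. k * B\<^sup>2)"
  proof (rule integral_mono_AE')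
    show "AE \<omega> in M. (\<Sum>i\<in>{1..n}. (Z i \<omega>)\<^sup>2) \<le> k * B\<^sup>2"
    proof (rule AE_I2)
      fix \<omega>
      have "(\<Sum>i\<in>{1..n}. (Z i \<omega>)\<^sup>2)
          \<le> (\<Sum>i\<in>{1..n}. B\<^sup>2 * of_bool (i \<in> nearest_neighbors (\<lambda>i. Xs i \<omega>) n k x))"
        by (rule sum_mono) (rule Z_sq)
      also have "\<dots> = B\<^sup>2 * card (nearest_neighbors (\<lambda>i. Xs i \<omega>) n k x)"
      proof -
        have "{1..n} \<inter> nearest_neighbors (\<lambda>i. Xs i \<omega>) n k x = nearest_neighbors (\<lambda>i. Xs i \<omega>) n k x"
          by (auto simp: nearest_neighbors_def)
        then show ?thesis
          by (simp add: sum_distrib_left[symmetric])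
      qed
      also have "\<dots> \<le> B\<^sup>2 * k"
        by (intro mult_left_mono) (auto simp: card_nearest_neighbors_le)
      finally show "(\<Sum>i\<in>{1..n}. (Z i \<omega>)\<^sup>2) \<le> k * B\<^sup>2" by (simp add: mult.commute)
    qed
  qed (auto intro!: sum_nonneg)
  finally show "expectation (\<lambda>\<omega>. (S \<omega>)\<^sup>2) \<le> k * B\<^sup>2"
    by (simp add: prob_space)
qed

section \<open>Regularity of the sample\<close>

lemma (in prob_space) count_measurable:
  assumes "finite I" and A: "A \<in> sets N" and W: "\<And>i. i \<in> I \<Longrightarrow> W i \<in> measurable M N"
  shows "(\<lambda>\<omega>. real (card {i \<in> I. W i \<omega> \<in> A})) \<in> borel_measurable M"
proof -
  have "(\<lambda>\<omega>. \<Sum>i\<in>I. indicator A (W i \<omega>) :: real) \<in> borel_measurable M"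
    by (intro borel_measurable_sum measurable_compose[OF W borel_measurable_indicator[OF A]])
  also have "(\<lambda>\<omega>. \<Sum>i\<in>I. indicator A (W i \<omega>) :: real) = (\<lambda>\<omega>. real (card {i \<in> I. W i \<omega> \<in> A}))"
    using assms(1) by (simp add: indicator_def of_bool_def sum.If_cases Int_def)
  finally show ?thesis .
qed

text \<open>A count below \<open>s\<close> deviates by at least half of its mean \<open>m\<close>;
  Chebyshev then yields \<open>4 / m\<close>, and \<open>m \<ge> 2 * s\<close>.\<close>

lemma (in prob_space) count_below_half:
  fixes q s :: real
  assumes indep: "indep_vars (\<lambda>_. N) W I" and "finite I" and A: "A \<in> sets N"
    and q: "\<And>i. i \<in> I \<Longrightarrow> prob {\<omega> \<in> space M. W i \<omega> \<in> A} = q"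
    and s: "0 < s" "s \<le> card I * q / 2"
  shows "{\<omega> \<in> space M. card {i \<in> I. W i \<omega> \<in> A} < s} \<in> events"
    and "prob {\<omega> \<in> space M. card {i \<in> I. W i \<omega> \<in> A} < s} \<le> 2 / s"
proof -
  define m where "m = card I * q"
  have W: "W i \<in> measurable M N" if "i \<in> I" for i
    using indep that unfolding indep_vars_def2 by simp
  note [measurable] = count_measurable[OF \<open>finite I\<close> A W]
  show "{\<omega> \<in> space M. card {i \<in> I. W i \<omega> \<in> A} < s} \<in> events" by measurable
  have m: "0 < m / 2" using s by (simp add: m_def)
  have "prob {\<omega> \<in> space M. card {i \<in> I. W i \<omega> \<in> A} < s}
     \<le> prob {\<omega> \<in> space M. m / 2 \<le> \<bar>real (card {i \<in> I. W i \<omega> \<in> A}) - m\<bar>}"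
  proof (rule finite_measure_mono)
    show "{\<omega> \<in> space M. card {i \<in> I. W i \<omega> \<in> A} < s}
        \<subseteq> {\<omega> \<in> space M. m / 2 \<le> \<bar>real (card {i \<in> I. W i \<omega> \<in> A}) - m\<bar>}"
      using s(2) unfolding m_def[symmetric] by (intro Collect_mono) (auto simp: abs_real_def)
  qed measurable
  also have "\<dots> \<le> m / (m / 2)\<^sup>2"
    unfolding m_def using m by (intro count_Chebyshev[OF indep \<open>finite I\<close> A q]) (auto simp: m_def)
  also have "\<dots> = 4 / m" using m by (simp add: power2_eq_square field_simps)
  also have "\<dots> \<le> 4 / (2 * s)" using s by (intro divide_left_mono) (auto simp: m_def)
  finally show "prob {\<omega> \<in> space M. card {i \<in> I. W i \<omega> \<in> A} < s} \<le> 2 / s" by simp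
qed

text \<open>A count above \<open>s\<close> exceeds its mean by at least \<open>s / 4\<close>; the
  value 12 is \<open>(3 / 4) / (1 / 4)^2\<close>.\<close>

lemma (in prob_space) count_above:
  fixes q s :: real
  assumes indep: "indep_vars (\<lambda>_. N) W I" and "finite I" and A: "A \<in> sets N"
    and q: "\<And>i. i \<in> I \<Longrightarrow> prob {\<omega> \<in> space M. W i \<omega> \<in> A} = q"
    and s: "0 < s" "card I * q \<le> 3 / 4 * s"
  shows "{\<omega> \<in> space M. s < card {i \<in> I. W i \<omega> \<in> A}} \<in> events"
    and "prob {\<omega> \<in> space M. s < card {i \<in> I. W i \<omega> \<in> A}} \<le> 12 / s"
proof -
  define m where "m = card I * q"
  have W: "W i \<in> measurable M N" if "i \<in> I" for i
    using indep that unfolding indep_vars_def2 by simp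
  note [measurable] = count_measurable[OF \<open>finite I\<close> A W]
  show "{\<omega> \<in> space M. s < card {i \<in> I. W i \<omega> \<in> A}} \<in> events" by measurable
  have "prob {\<omega> \<in> space M. s < card {i \<in> I. W i \<omega> \<in> A}}
     \<le> prob {\<omega> \<in> space M. s / 4 \<le> \<bar>real (card {i \<in> I. W i \<omega> \<in> A}) - m\<bar>}"
  proof (rule finite_measure_mono)
    show "{\<omega> \<in> space M. s < card {i \<in> I. W i \<omega> \<in> A}}
        \<subseteq> {\<omega> \<in> space M. s / 4 \<le> \<bar>real (card {i \<in> I. W i \<omega> \<in> A}) - m\<bar>}"
      using s(2) by (auto simp: m_def)
  qed measurable
  also have "\<dots> \<le> m / (s / 4)\<^sup>2"
    unfolding m_def using s by (intro count_Chebyshev[OF indep \<open>finite I\<close> A q]) auto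
  also have "\<dots> \<le> (3 / 4 * s) / (s / 4)\<^sup>2"
    using s by (intro divide_right_mono) (auto simp: m_def)
  also have "\<dots> = 12 / s" using s by (simp add: power2_eq_square field_simps)
  finally show "prob {\<omega> \<in> space M. s < card {i \<in> I. W i \<omega> \<in> A}} \<le> 12 / s" .
qed

lemma (in prob_space) independent_copiesD:
  fixes X :: "'a \<Rightarrow> real ^ 'p"
  assumes [measurable]: "Y \<in> borel_measurable M" "X \<in> borel_measurable M"
    and copies: "independent_copies M Ys Xs Y X"
  shows "indep_vars (\<lambda>_. borel) Xs {1..}"
    and "i \<ge> 1 \<Longrightarrow> A \<in> sets borel \<Longrightarrow>
      prob {\<omega> \<in> space M. Xs i \<omega> \<in> A} = prob {\<omega> \<in> space M. X \<omega> \<in> A}"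
proof -
  let ?N = "borel \<Otimes>\<^sub>M borel :: (real \<times> (real ^ 'p)) measure"
  have indep: "indep_vars (\<lambda>_. ?N) (\<lambda>i \<omega>. (Ys i \<omega>, Xs i \<omega>)) {1..}"
    and eq: "\<And>i. i \<ge> 1 \<Longrightarrow> distr M ?N (\<lambda>\<omega>. (Ys i \<omega>, Xs i \<omega>)) = distr M ?N (\<lambda>\<omega>. (Y \<omega>, X \<omega>))"
    using copies by (auto simp: independent_copies_def)
  show "indep_vars (\<lambda>_. borel) Xs {1..}"
    using indep_vars_compose2[OF indep, of "\<lambda>_. snd" "\<lambda>_. borel"] by simp
  assume i: "i \<ge> 1" and [measurable]: "A \<in> sets borel"
  have W [measurable]: "(\<lambda>\<omega>. (Ys i \<omega>, Xs i \<omega>)) \<in> measurable M ?N"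
    using indep i unfolding indep_vars_def2 by simp
  have "prob {\<omega> \<in> space M. Xs i \<omega> \<in> A} = measure (distr M ?N (\<lambda>\<omega>. (Ys i \<omega>, Xs i \<omega>))) (UNIV \<times> A)"
    by (subst measure_distr) (auto intro!: arg_cong[where f = prob])
  also have "\<dots> = prob {\<omega> \<in> space M. X \<omega> \<in> A}"
    unfolding eq[OF i] by (subst measure_distr) (auto intro!: arg_cong[where f = prob])
  finally show "prob {\<omega> \<in> space M. Xs i \<omega> \<in> A} = prob {\<omega> \<in> space M. X \<omega> \<in> A}" .
qed

section \<open>Probability of small balls\<close>

lemma measure_lborel_ball:
  fixes y :: "'b::euclidean_space"
  assumes "0 \<le> r"
  shows "measure lborel (ball y r) = r ^ DIM('b) * measure lborel (ball (0 :: 'b) 1)"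
  using content_ball[OF assms, of y] content_ball[of 1 "0 :: 'b"] by simp

text \<open>Near \<open>x\<close> continuity keeps the density within a factor 1/2 to 3/2 of
  \<open>f x\<close>. Centers \<open>y\<close> other than \<open>x\<close> are allowed for the sake
  of the anchor balls.\<close>

lemma (in prob_space) density_ball_mass:
  fixes X :: "'a \<Rightarrow> 'b::euclidean_space" and f :: "'b \<Rightarrow> real"
  assumes dist: "distributed M lborel X (\<lambda>z. ennreal (f z))" and "\<And>z. 0 \<le> f z"
    and cont: "isCont f x" and "0 < f x"
  defines "V \<equiv> measure lborel (ball (0 :: 'b) 1)"
  obtains \<rho> where "0 < \<rho>"
    "\<And>y r. 0 \<le> r \<Longrightarrow> dist x y + r \<le> \<rho> \<Longrightarrow>
       f x / 2 * (r ^ DIM('b) * V) \<le> prob {\<omega> \<in> space M. X \<omega> \<in> ball y r} \<and>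
       prob {\<omega> \<in> space M. X \<omega> \<in> ball y r} \<le> 3 / 2 * f x * (r ^ DIM('b) * V)"
proof -
  obtain \<rho> where \<rho>: "0 < \<rho>" "\<And>z. dist z x < \<rho> \<Longrightarrow> dist (f z) (f x) < f x / 2"
    using cont \<open>0 < f x\<close> unfolding continuous_at_eps_delta by (metis half_gt_zero)
  show ?thesis
  proof (rule that[OF \<rho>(1)])
    fix y r assume r: "0 \<le> r" "dist x y + r \<le> \<rho>"
    let ?B = "ball y r"
    define P where "P = prob {\<omega> \<in> space M. X \<omega> \<in> ?B}"
    have near: "f x / 2 \<le> f z \<and> f z \<le> 3 / 2 * f x" if "z \<in> ?B" for z
    proof -
      have "dist z x < \<rho>"
        using that r dist_triangle[of z x y] by (simp add: dist_commute)
      from \<rho>(2)[OF this] show ?thesis unfolding dist_real_def abs_less_iff by linarith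
    qed
    have vol: "emeasure lborel ?B = ennreal (r ^ DIM('b) * V)"
      unfolding V_def measure_lborel_ball[OF r(1), of y, symmetric]
      by (rule emeasure_eq_ennreal_measure) (use emeasure_lborel_ball_finite[of y r] in auto)
    have const: "(\<integral>\<^sup>+z. ennreal a * indicator ?B z \<partial>lborel) = ennreal (a * (r ^ DIM('b) * V))"
      if "0 \<le> a" for a
      using that by (simp add: nn_integral_cmult_indicator vol ennreal_mult' )
    have "ennreal P = emeasure M (X -` ?B \<inter> space M)"
      unfolding P_def emeasure_eq_measure by (auto intro!: arg_cong[where f = prob])
    also have "\<dots> = (\<integral>\<^sup>+z. ennreal (f z) * indicator ?B z \<partial>lborel)"
      by (rule distributed_emeasure[OF dist]) simp
    finally have P: "ennreal P = (\<integral>\<^sup>+z. ennreal (f z) * indicator ?B z \<partial>lborel)" .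
    have V0: "0 \<le> r ^ DIM('b) * V" using r by (simp add: V_def)
    have "ennreal (f x / 2 * (r ^ DIM('b) * V)) \<le> ennreal P"
      unfolding P const[of "f x / 2", OF less_imp_le[OF half_gt_zero[OF \<open>0 < f x\<close>]], symmetric]
    proof (rule nn_integral_mono)
      show "ennreal (f x / 2) * indicator ?B z \<le> ennreal (f z) * indicator ?B z" for z
        using near[of z] by (cases "z \<in> ?B") (auto intro!: ennreal_leI)
    qed
    moreover have "ennreal P \<le> ennreal (3 / 2 * f x * (r ^ DIM('b) * V))"
    proof -
      have nonneg: "0 \<le> 3 / 2 * f x" using \<open>0 < f x\<close> by simp
      show ?thesis
        unfolding P const[OF nonneg, symmetric]
      proof (rule nn_integral_mono)
        show "ennreal (f z) * indicator ?B z \<le> ennreal (3 / 2 * f x) * indicator ?B z" for z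
          using near[of z] by (cases "z \<in> ?B") (auto intro!: ennreal_leI)
      qed
    qed
    ultimately show "f x / 2 * (r ^ DIM('b) * V) \<le> prob {\<omega> \<in> space M. X \<omega> \<in> ?B} \<and>
       prob {\<omega> \<in> space M. X \<omega> \<in> ?B} \<le> 3 / 2 * f x * (r ^ DIM('b) * V)"
      unfolding P_def[symmetric] using V0 \<open>0 < f x\<close>
      by (auto simp: ennreal_le_iff P_def)
  qed
qed

text \<open>\<open>Bad\<close> unites four kinds of events: too few points within
  \<open>4 * \<tau>\<close> of \<open>x\<close> and too many within \<open>\<tau> / 2\<close>
  (together \<open>14 / k\<close>), too few points near one of the \<open>2 * p\<close> anchors
  (each at most \<open>2 / (m * k)\<close> with \<open>m = v ^ p / 4\<close>), and a large noise sum
  in one of \<open>p + 1\<close> directions (each at most \<open>16 / A^2\<close>).\<close>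

lemma (in prob_space) sample_regularity:
  fixes Xs :: "nat \<Rightarrow> 'a \<Rightarrow> real ^ 'p" and X :: "'a \<Rightarrow> real ^ 'p" and n k :: nat and x
    and \<tau> A :: real
  assumes YX: "Y \<in> borel_measurable M" "X \<in> borel_measurable M"
    and copies: "independent_copies M Ys Xs Y X"
    and reg: "is_regression_function M Y X r"
    and pos: "1 \<le> k" "0 < \<tau>" "0 < A"
    and mass: "\<And>y (a::real). 0 \<le> a \<Longrightarrow> dist x y + a * \<tau> \<le> 4 * \<tau> \<Longrightarrow>
      a ^ CARD('p) * k / 2 \<le> n * prob {\<omega> \<in> space M. X \<omega> \<in> ball y (a * \<tau>)} \<and>
      n * prob {\<omega> \<in> space M. X \<omega> \<in> ball y (a * \<tau>)} \<le> 3 / 2 * a ^ CARD('p) * k"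
  obtains Bad where "Bad \<in> events"
    "prob Bad \<le> (14 + 16 * real CARD('p) * (8 * CARD('p)) ^ CARD('p)) / k + 16 * (CARD('p) + 1) / A\<^sup>2"
    "\<And>\<omega>. \<omega> \<in> space M - Bad \<Longrightarrow> k \<le> card {j \<in> {1..n}. dist (Xs j \<omega>) x < 4 * \<tau>}"
    "\<And>\<omega>. \<omega> \<in> space M - Bad \<Longrightarrow> card {j \<in> {1..n}. dist (Xs j \<omega>) x < \<tau> / 2} \<le> k"
    "\<And>\<omega> j s. \<omega> \<in> space M - Bad \<Longrightarrow> s \<in> {-1, 1} \<Longrightarrow>
       (1 / (8 * CARD('p))) ^ CARD('p) / 4 * k
         \<le> card {i \<in> {1..n}. dist (Xs i \<omega>) (x + (s * \<tau> / 4) *\<^sub>R axis j 1) < \<tau> / (8 * CARD('p))}"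
    "\<And>\<omega>. \<omega> \<in> space M - Bad \<Longrightarrow>
       \<bar>\<Sum>i\<in>nearest_neighbors (\<lambda>i. Xs i \<omega>) n k x. residual r (Ys i \<omega>, Xs i \<omega>)\<bar> \<le> A * sqrt k"
    "\<And>\<omega> j. \<omega> \<in> space M - Bad \<Longrightarrow>
       \<bar>\<Sum>i\<in>nearest_neighbors (\<lambda>i. Xs i \<omega>) n k x. residual r (Ys i \<omega>, Xs i \<omega>) *
          (indicator (ball x (4 * \<tau>)) (Xs i \<omega>) * (Xs i \<omega> - x) $ j / \<tau>)\<bar> \<le> A * sqrt k"
proof -
  define p where "p = CARD('p)"
  have p: "1 \<le> p" unfolding p_def by (simp add: Suc_le_eq)
  define v where "v = 1 / (8 * real p)"
  have v: "0 < v" "v \<le> 1 / 8" using p by (auto simp: v_def field_simps)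
  define m where "m = v ^ p / 4"
  have m: "0 < m" using v by (simp add: m_def)
  define anchor :: "'p \<times> real \<Rightarrow> real ^ 'p" where
    "anchor = (\<lambda>(j, s). x + (s * \<tau> / 4) *\<^sub>R axis j 1)"
  have kpos: "0 < real k" using pos by simp
  have indep: "indep_vars (\<lambda>_. borel) Xs {1..n}"
    by (rule indep_vars_subset[OF independent_copiesD(1)[OF YX copies]]) auto
  have q: "prob {\<omega> \<in> space M. Xs i \<omega> \<in> B} = prob {\<omega> \<in> space M. X \<omega> \<in> B}"
    if "i \<in> {1..n}" "B \<in> sets borel" for i B
    using that by (intro independent_copiesD(2)[OF YX copies]) auto
  have ball: "ball y a \<in> sets borel" for y :: "real ^ 'p" and a by simp
  define B1 where "B1 = {\<omega> \<in> space M. card {i \<in> {1..n}. Xs i \<omega> \<in> ball x (4 * \<tau>)} < real k}"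
  define B2 where "B2 = {\<omega> \<in> space M. real k < card {i \<in> {1..n}. Xs i \<omega> \<in> ball x (1 / 2 * \<tau>)}}"
  define B3 where "B3 c = {\<omega> \<in> space M. card {i \<in> {1..n}. Xs i \<omega> \<in> ball (anchor c) (v * \<tau>)} < m * k}" for c
  \<comment> \<open>\<open>None\<close> is the intercept direction and \<open>Some j\<close> the
    \<open>j\<close>-th slope. The indicator makes the weight bounded by 4 everywhere, as the
    second-moment bound requires, and equals 1 at the neighbors on the good event.\<close>
  define \<phi> :: "'p option \<Rightarrow> real ^ 'p \<Rightarrow> real" where
    "\<phi> c = (case c of None \<Rightarrow> (\<lambda>_. 1)
       | Some j \<Rightarrow> (\<lambda>z. indicator (ball x (4 * \<tau>)) z * (z - x) $ j / \<tau>))" for c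
  define S where "S c \<omega> = (\<Sum>i\<in>nearest_neighbors (\<lambda>i. Xs i \<omega>) n k x.
    residual r (Ys i \<omega>, Xs i \<omega>) * \<phi> c (Xs i \<omega>))" for c \<omega>
  define B4 where "B4 c = {\<omega> \<in> space M. A * sqrt k \<le> \<bar>S c \<omega>\<bar>}" for c
  have B1: "B1 \<in> events" "prob B1 \<le> 2 / k"
  proof -
    have "real k \<le> card {1..n} * prob {\<omega> \<in> space M. X \<omega> \<in> ball x (4 * \<tau>)} / 2"
    proof -
      \<comment> \<open>The factor 4 in the radius makes the expected count at least
        \<open>2 * k\<close> in every dimension, so that \<open>k\<close> is at most half of
        it.\<close>
      have "(4::real) \<le> 4 ^ CARD('p)" using self_le_power[of 4 "CARD('p)"] by simp
      then have "4 * real k \<le> 4 ^ CARD('p) * real k" by (intro mult_right_mono) auto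
      moreover have "4 ^ CARD('p) * real k / 2 \<le> n * prob {\<omega> \<in> space M. X \<omega> \<in> ball x (4 * \<tau>)}"
        using mass[of 4 x] pos by simp
      ultimately show ?thesis unfolding card_atLeastAtMost diff_Suc_1 by linarith
    qed
    note c = count_below_half[OF indep finite_atLeastAtMost ball q[OF _ ball] kpos this]
    show "B1 \<in> events"
      unfolding B1_def by (rule c(1))
    show "prob B1 \<le> 2 / k"
      unfolding B1_def by (rule c(2))
  qed
  have B2: "B2 \<in> events" "prob B2 \<le> 12 / k"
  proof -
    have "card {1..n} * prob {\<omega> \<in> space M. X \<omega> \<in> ball x (1 / 2 * \<tau>)} \<le> 3 / 4 * real k"
    proof -
      \<comment> \<open>Halving the radius brings the expected count down to at most
        \<open>3 / 4 * k\<close> in every dimension.\<close>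
      have "(1 / 2 :: real) ^ CARD('p) \<le> 1 / 2"
        using power_decreasing[of 1 "CARD('p)" "1 / 2 :: real"] p by (simp add: p_def)
      then have "3 / 2 * (1 / 2) ^ CARD('p) * real k \<le> 3 / 2 * (1 / 2) * real k"
        by (intro mult_right_mono mult_left_mono) auto
      moreover have "n * prob {\<omega> \<in> space M. X \<omega> \<in> ball x (1 / 2 * \<tau>)} \<le> 3 / 2 * (1 / 2) ^ CARD('p) * k"
        using mass[of "1 / 2" x] pos by (simp del: mem_ball)
      ultimately show ?thesis unfolding card_atLeastAtMost diff_Suc_1 by linarith
    qed
    note c = count_above[OF indep finite_atLeastAtMost ball q[OF _ ball] kpos this]
    show "B2 \<in> events"
      unfolding B2_def by (rule c(1))
    show "prob B2 \<le> 12 / k"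
      unfolding B2_def by (rule c(2))
  qed
  have B3: "B3 c \<in> events" "prob (B3 c) \<le> 2 / (m * k)" if "c \<in> UNIV \<times> {-1, 1}" for c
  proof -
    \<comment> \<open>The anchor ball reaches at most \<open>\<tau> / 4 + \<tau> / 8\<close> from
      \<open>x\<close>, well within the range of \<open>mass\<close>.\<close>
    have "dist x (anchor c) = \<tau> / 4"
      using that pos by (auto simp: anchor_def dist_norm)
    moreover have "v * \<tau> \<le> 1 / 8 * \<tau>" using v pos by (intro mult_right_mono) auto
    ultimately have "v ^ p * k / 2 \<le> n * prob {\<omega> \<in> space M. X \<omega> \<in> ball (anchor c) (v * \<tau>)}"
      using mass[of v "anchor c"] v pos unfolding p_def by linarith
    then have "m * k \<le> card {1..n} * prob {\<omega> \<in> space M. X \<omega> \<in> ball (anchor c) (v * \<tau>)} / 2"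
      unfolding m_def card_atLeastAtMost diff_Suc_1 by linarith
    note c = count_below_half[OF indep finite_atLeastAtMost ball q[OF _ ball] mult_pos_pos[OF m kpos] this]
    show "B3 c \<in> events"
      unfolding B3_def by (rule c(1))
    show "prob (B3 c) \<le> 2 / (m * k)"
      unfolding B3_def by (rule c(2))
  qed
  have B4: "B4 c \<in> events" "prob (B4 c) \<le> 16 / A\<^sup>2" for c
  proof -
    have "(\<lambda>z :: real ^ 'p. (z - x) $ j) \<in> borel_measurable borel" for j
      by (intro borel_measurable_continuous_onI continuous_intros)
    then have meas: "\<phi> c \<in> borel_measurable borel"
      unfolding \<phi>_def
      by (cases c) (auto simp del: vector_minus_component intro!: borel_measurable_times
          borel_measurable_divide borel_measurable_indicator)
    have bound: "\<bar>\<phi> c z\<bar> \<le> 4" for z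
    proof (cases c)
      case (Some j)
      show ?thesis
      proof (cases "z \<in> ball x (4 * \<tau>)")
        case True
        then have "\<bar>(z - x) $ j\<bar> \<le> 4 * \<tau>"
          using component_le_norm_cart[of "z - x" j] by (simp add: dist_norm norm_minus_commute)
        then show ?thesis using True pos Some by (simp add: \<phi>_def field_simps)
      qed (simp add: \<phi>_def Some)
    qed (simp add: \<phi>_def)
    note moments = score_second_moment[OF YX copies reg meas bound, of n k x]
    have S: "S c \<in> borel_measurable M" "integrable M (\<lambda>\<omega>. (S c \<omega>)\<^sup>2)"
      "expectation (\<lambda>\<omega>. (S c \<omega>)\<^sup>2) \<le> real k * 4\<^sup>2"
      unfolding S_def[abs_def] by (rule moments)+
    then show "B4 c \<in> events" unfolding B4_def by measurable
    have "prob (B4 c) \<le> expectation (\<lambda>\<omega>. (S c \<omega>)\<^sup>2) / (A * sqrt k)\<^sup>2"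
      unfolding B4_def using S pos by (intro second_moment_method) auto
    also have "\<dots> \<le> real k * 4\<^sup>2 / (A * sqrt k)\<^sup>2"
      by (intro divide_right_mono S) auto
    also have "\<dots> = 16 / A\<^sup>2" using pos by (simp add: power_mult_distrib)
    finally show "prob (B4 c) \<le> 16 / A\<^sup>2" .
  qed
  define C3 where "C3 = (\<Union>c\<in>UNIV \<times> {-1, 1}. B3 c)"
  define C4 where "C4 = (\<Union>c. B4 c)"
  have C3: "C3 \<in> events" "prob C3 \<le> 2 * p * (2 / (m * k))"
  proof -
    have fin: "finite (UNIV \<times> {-1, 1} :: ('p \<times> real) set)" by simp
    show "C3 \<in> events" unfolding C3_def using B3(1) by (intro sets.finite_UN fin)
    have "prob C3 \<le> (\<Sum>c\<in>UNIV \<times> {-1, 1}. prob (B3 c))"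
      unfolding C3_def using B3(1) by (intro finite_measure_subadditive_finite fin) auto
    also have "\<dots> \<le> card (UNIV \<times> {-1, 1} :: ('p \<times> real) set) * (2 / (m * k))"
      using B3(2) by (rule sum_bounded_above)
    also have "card (UNIV \<times> {-1, 1} :: ('p \<times> real) set) = 2 * p"
      by (simp add: card_cartesian_product p_def)
    finally show "prob C3 \<le> 2 * p * (2 / (m * k))" by simp
  qed
  have C4: "C4 \<in> events" "prob C4 \<le> (p + 1) * (16 / A\<^sup>2)"
  proof -
    have fin: "finite (UNIV :: 'p option set)" by simp
    show "C4 \<in> events" unfolding C4_def by (intro sets.finite_UN fin B4)
    have "prob C4 \<le> (\<Sum>c\<in>UNIV. prob (B4 c))"
      unfolding C4_def by (intro finite_measure_subadditive_finite fin) (auto simp: B4)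
    also have "\<dots> \<le> card (UNIV :: 'p option set) * (16 / A\<^sup>2)"
      using B4(2) by (rule sum_bounded_above)
    also have "card (UNIV :: 'p option set) = p + 1"
      by (simp add: card_UNIV_option p_def)
    finally show "prob C4 \<le> (p + 1) * (16 / A\<^sup>2)" by simp
  qed
  define Bad where "Bad = (B1 \<union> B2) \<union> (C3 \<union> C4)"
  have ev: "Bad \<in> events" unfolding Bad_def by (intro sets.Un B1 B2 C3 C4)
  have "prob Bad \<le> prob (B1 \<union> B2) + prob (C3 \<union> C4)"
    unfolding Bad_def by (intro measure_Un_le sets.Un B1 B2 C3 C4)
  also have "\<dots> \<le> (prob B1 + prob B2) + (prob C3 + prob C4)"
    by (intro add_mono measure_Un_le B1 B2 C3 C4)
  also have "\<dots> \<le> (2 / k + 12 / k) + (2 * p * (2 / (m * k)) + (p + 1) * (16 / A\<^sup>2))"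
    by (intro add_mono B1 B2 C3 C4)
  also have "\<dots> = (14 + 16 * real p * (8 * p) ^ p) / k + 16 * (p + 1) / A\<^sup>2"
    by (simp add: m_def v_def add_divide_distrib power_divide mult_ac)
  finally have prob_Bad: "prob Bad \<le> (14 + 16 * real p * (8 * p) ^ p) / k + 16 * (p + 1) / A\<^sup>2" .
  show ?thesis
  proof (rule that[OF ev prob_Bad[unfolded p_def]])
    fix \<omega> assume \<omega>: "\<omega> \<in> space M - Bad"
    show "k \<le> card {j \<in> {1..n}. dist (Xs j \<omega>) x < 4 * \<tau>}"
      using \<omega> by (auto simp: Bad_def B1_def dist_commute)
    show "card {j \<in> {1..n}. dist (Xs j \<omega>) x < \<tau> / 2} \<le> k"
      using \<omega> by (auto simp: Bad_def B2_def dist_commute)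
    show "(1 / (8 * CARD('p))) ^ CARD('p) / 4 * k
         \<le> card {i \<in> {1..n}. dist (Xs i \<omega>) (x + (s * \<tau> / 4) *\<^sub>R axis j 1) < \<tau> / (8 * CARD('p))}"
      if "s \<in> {-1, 1}" for j s
    proof -
      have "\<omega> \<notin> B3 (j, s)" using \<omega> that by (auto simp: Bad_def C3_def)
      then show ?thesis
        using \<omega> by (simp add: B3_def anchor_def dist_commute m_def v_def p_def not_less)
    qed
    have S: "\<bar>S c \<omega>\<bar> \<le> A * sqrt k" for c
    proof -
      have "\<omega> \<notin> B4 c" using \<omega> by (auto simp: Bad_def C4_def)
      then show ?thesis using \<omega> by (simp add: B4_def)
    qed
    show "\<bar>\<Sum>i\<in>nearest_neighbors (\<lambda>i. Xs i \<omega>) n k x. residual r (Ys i \<omega>, Xs i \<omega>)\<bar> \<le> A * sqrt k"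
      using S[of None] by (simp add: S_def \<phi>_def)
    show "\<bar>\<Sum>i\<in>nearest_neighbors (\<lambda>i. Xs i \<omega>) n k x. residual r (Ys i \<omega>, Xs i \<omega>) *
          (indicator (ball x (4 * \<tau>)) (Xs i \<omega>) * (Xs i \<omega> - x) $ j / \<tau>)\<bar> \<le> A * sqrt k" for j
      using S[of "Some j"] by (simp add: S_def \<phi>_def)
  qed
qed

text \<open>The deterministic half: on a regular sample the localization applies with
  \<open>K = sqrt k\<close>. Its score constant \<open>A + 64 * C * T\<close> adds the noise bound
  and the bias bound; the curvature constant comes from the anchors.\<close>

lemma maximizer_on_regular_sample:
  fixes xs :: "nat \<Rightarrow> real ^ 'p" and ys :: "nat \<Rightarrow> real" and b0 :: "real ^ 'p"
    and \<pi> :: "real ^ 'p \<Rightarrow> real"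
    and n k :: nat and \<tau> lam D C A T L \<kappa> a0 m :: real
  defines "m \<equiv> (1 / (8 * CARD('p))) ^ CARD('p) / 4"
  assumes pos: "1 \<le> k" "0 < \<tau>" "0 \<le> lam" "0 < D" "0 \<le> C"
    and outer: "k \<le> card {j \<in> {1..n}. dist (xs j) x < 4 * \<tau>}"
    and inner: "card {j \<in> {1..n}. dist (xs j) x < \<tau> / 2} \<le> k"
    and anchors: "\<And>j s. s \<in> {-1, 1} \<Longrightarrow>
       m * k \<le> card {i \<in> {1..n}. dist (xs i) (x + (s * \<tau> / 4) *\<^sub>R axis j 1) < \<tau> / (8 * CARD('p))}"
    and score0: "\<bar>\<Sum>i\<in>nearest_neighbors xs n k x. ys i - \<pi> (xs i)\<bar> \<le> A * sqrt k"
    and score: "\<And>j. \<bar>\<Sum>i\<in>nearest_neighbors xs n k x. (ys i - \<pi> (xs i)) *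
       (indicator (ball x (4 * \<tau>)) (xs i) * (xs i - x) $ j / \<tau>)\<bar> \<le> A * sqrt k"
    and bias: "\<And>z. dist z x < 4 * \<tau> \<Longrightarrow> \<bar>\<pi> z - expit (a0 + b0 \<bullet> (z - x))\<bar> \<le> C * (dist z x)\<^sup>2"
    and small: "\<tau>\<^sup>2 * sqrt k \<le> T" "norm b0 * (4 * \<tau>) \<le> 1 / 2" "lam \<le> L * sqrt k * \<tau>"
    and \<kappa>: "0 < \<kappa>" "\<And>s. \<bar>s - a0\<bar> \<le> 1 \<Longrightarrow> \<kappa> \<le> expit s * (1 - expit s)"
    and D: "8 * D \<le> sqrt k" "A + 64 * C * T + L < \<kappa> * (m / (64 * (real CARD('p))\<^sup>2)) / 2 * D"
  shows "\<exists>ab. is_maximizer ys xs n k lam x ab"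
    and "is_maximizer ys xs n k lam x (a, b) \<Longrightarrow> \<tau> * norm (b - b0) \<le> D / sqrt k"
proof -
  define N where "N = nearest_neighbors xs n k x"
  define z where "z i = xs i - x" for i
  define e where "e i = expit (a0 + b0 \<bullet> z i)" for i
  have K: "0 < sqrt k" and KK: "(sqrt k)\<^sup>2 = k" using pos by auto
  have T: "0 \<le> T" using small(1) by (smt (verit) mult_nonneg_nonneg real_sqrt_ge_zero zero_le_power2 of_nat_0_le_iff)
  have m: "0 \<le> m" by (simp add: m_def)
  have near: "norm (z i) < 4 * \<tau>" if "i \<in> N" for i
    using nearest_neighbors_dist_less[OF that[unfolded N_def] outer] by (simp add: z_def dist_norm)
  \<comment> \<open>At most \<open>k\<close> neighbors contribute a bias of
    \<open>C * (4 * \<tau>)^2\<close> each, and \<open>\<tau>^2 * k \<le> T * sqrt k\<close>. Slope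
    weights of size up to \<open>4 * \<tau>\<close> later turn 16 into 64.\<close>
  have bias_sum: "\<bar>\<Sum>i\<in>N. (\<pi> (xs i) - e i) * w i\<bar> \<le> 16 * C * T * sqrt k * u"
    if w: "\<And>i. i \<in> N \<Longrightarrow> \<bar>w i\<bar> \<le> u" and "0 \<le> u" for w u
  proof -
    have "\<bar>\<Sum>i\<in>N. (\<pi> (xs i) - e i) * w i\<bar> \<le> (\<Sum>i\<in>N. \<bar>(\<pi> (xs i) - e i) * w i\<bar>)"
      by (rule sum_abs)
    also have "\<dots> \<le> card N * (C * (4 * \<tau>)\<^sup>2 * u)"
    proof (rule sum_bounded_above)
      fix i assume i: "i \<in> N"
      have d: "dist (xs i) x < 4 * \<tau>" using near[OF i] by (simp add: z_def dist_norm)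
      have "\<bar>\<pi> (xs i) - e i\<bar> \<le> C * (dist (xs i) x)\<^sup>2"
        using bias[OF d] by (simp add: e_def z_def)
      also have "\<dots> \<le> C * (4 * \<tau>)\<^sup>2"
        using d pos by (intro mult_left_mono power_mono) auto
      finally show "\<bar>(\<pi> (xs i) - e i) * w i\<bar> \<le> C * (4 * \<tau>)\<^sup>2 * u"
        unfolding abs_mult using w[OF i] pos by (intro mult_mono) auto
    qed
    also have "\<dots> \<le> k * (C * (4 * \<tau>)\<^sup>2 * u)"
      using card_nearest_neighbors_le[of xs n k x] pos \<open>0 \<le> u\<close>
      unfolding N_def by (intro mult_right_mono) auto
    also have "\<dots> = (sqrt k)\<^sup>2 * (C * (4 * \<tau>)\<^sup>2 * u)"
      by (simp only: KK)
    also have "\<dots> = 16 * C * sqrt k * u * (\<tau>\<^sup>2 * sqrt k)"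
      by (simp add: power2_eq_square del: real_sqrt_mult_self)
    also have "\<dots> \<le> 16 * C * sqrt k * u * T"
      using pos \<open>0 \<le> u\<close> by (intro mult_left_mono small) auto
    finally show ?thesis by (simp add: mult_ac)
  qed
  have CTK: "0 \<le> C * T * sqrt k" using pos T by simp
  have s0: "\<bar>\<Sum>i\<in>N. ys i - expit (a0 + b0 \<bullet> z i)\<bar> \<le> (A + 64 * C * T) * sqrt k"
  proof -
    have "(\<Sum>i\<in>N. ys i - e i) = (\<Sum>i\<in>N. ys i - \<pi> (xs i)) + (\<Sum>i\<in>N. (\<pi> (xs i) - e i) * 1)"
      by (simp add: sum.distrib[symmetric])
    moreover have "\<bar>\<Sum>i\<in>N. (\<pi> (xs i) - e i) * 1\<bar> \<le> 16 * C * T * sqrt k * 1"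
      by (rule bias_sum) auto
    moreover have "\<bar>\<Sum>i\<in>N. ys i - \<pi> (xs i)\<bar> \<le> A * sqrt k"
      using score0 by (simp add: N_def)
    moreover have "(A + 64 * C * T) * sqrt k = A * sqrt k + 64 * (C * T * sqrt k)"
      by (simp add: algebra_simps)
    ultimately show ?thesis
      using CTK unfolding e_def by linarith
  qed
  have sj: "\<bar>\<Sum>i\<in>N. (ys i - expit (a0 + b0 \<bullet> z i)) * z i $ j\<bar> \<le> (A + 64 * C * T) * sqrt k * \<tau>" for j
  proof -
    let ?s = "\<Sum>i\<in>N. (ys i - \<pi> (xs i)) * (indicator (ball x (4 * \<tau>)) (xs i) * (xs i - x) $ j / \<tau>)"
    \<comment> \<open>Splits the residual from the logistic model into noise and bias; the factor
      \<open>\<tau>\<close> undoes the normalization of the weight, whose indicator is 1 at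
      neighbors.\<close>
    have "(ys i - e i) * z i $ j = \<tau> * ((ys i - \<pi> (xs i)) * (indicator (ball x (4 * \<tau>)) (xs i) * (xs i - x) $ j / \<tau>))
        + (\<pi> (xs i) - e i) * z i $ j" if "i \<in> N" for i
    proof -
      have "indicator (ball x (4 * \<tau>)) (xs i) = (1::real)"
        using near[OF that] by (simp add: z_def dist_norm norm_minus_commute)
      moreover have "(u - v) * w = \<tau> * ((u - t) * (1 * w / \<tau>)) + (t - v) * w" for u v w t :: real
        using pos by (simp add: field_simps)
      ultimately show ?thesis unfolding z_def by metis
    qed
    then have "(\<Sum>i\<in>N. (ys i - e i) * z i $ j) = \<tau> * ?s + (\<Sum>i\<in>N. (\<pi> (xs i) - e i) * z i $ j)"
      by (simp add: sum.distrib sum_distrib_left)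
    moreover have "\<bar>\<Sum>i\<in>N. (\<pi> (xs i) - e i) * z i $ j\<bar> \<le> 16 * C * T * sqrt k * (4 * \<tau>)"
    proof (rule bias_sum)
      show "\<bar>z i $ j\<bar> \<le> 4 * \<tau>" if "i \<in> N" for i
        using component_le_norm_cart[of "z i" j] near[OF that] by simp
    qed (use pos in auto)
    moreover have "\<bar>\<tau> * ?s\<bar> \<le> \<tau> * (A * sqrt k)"
      using score[of j] pos unfolding abs_mult N_def by (simp add: mult_left_mono)
    moreover have "(A + 64 * C * T) * sqrt k * \<tau> = \<tau> * (A * sqrt k) + 16 * C * T * sqrt k * (4 * \<tau>)"
      by (simp add: algebra_simps)
    ultimately show ?thesis
      unfolding e_def by linarith
  qed
  have curv: "m / (64 * (real CARD('p))\<^sup>2) * (sqrt k)\<^sup>2 * (\<bar>\<alpha>\<bar> + \<tau> * l1_norm \<beta>)\<^sup>2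
      \<le> (\<Sum>i\<in>N. (\<alpha> + \<beta> \<bullet> z i)\<^sup>2)" for \<alpha> \<beta>
  proof (rule curvature_from_anchors)
    fix j and s :: real assume s: "s \<in> {-1, 1}"
    let ?c = "(s * \<tau> / 4) *\<^sub>R axis j 1 :: real ^ 'p"
    have "m * (sqrt k)\<^sup>2 \<le> card {i \<in> {1..n}. dist (xs i) (x + ?c) < \<tau> / (8 * CARD('p))}"
      unfolding KK by (rule anchors[OF s])
    also have "\<dots> \<le> card {i \<in> N. dist (z i) ?c < \<tau> / (8 * CARD('p))}"
    proof (intro of_nat_mono card_mono subsetI)
      fix i assume "i \<in> {i \<in> {1..n}. dist (xs i) (x + ?c) < \<tau> / (8 * CARD('p))}"
      then have i: "i \<in> {1..n}" "dist (z i) ?c < \<tau> / (8 * CARD('p))"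
        by (auto simp: z_def dist_norm algebra_simps)
      \<comment> \<open>Sample points in an anchor ball are within
        \<open>\<tau> / 4 + \<tau> / 8 < \<tau> / 2\<close> of \<open>x\<close>, so
        \<open>inner\<close> makes them neighbors.\<close>
      have "\<tau> / (8 * CARD('p)) \<le> \<tau> / 8"
        using pos by (intro divide_left_mono) (auto simp: Suc_le_eq)
      moreover have "norm ?c = \<tau> / 4" using s pos by auto
      moreover have "norm (z i) \<le> dist (z i) ?c + norm ?c"
        unfolding dist_norm by (metis norm_triangle_sub add.commute)
      ultimately have "norm (z i) < \<tau> / 2" using i(2) pos by linarith
      then have "i \<in> N"
        unfolding N_def by (intro in_nearest_neighborsI[OF i(1) _ inner]) (simp add: z_def dist_norm)
      then show "i \<in> {i \<in> N. dist (z i) ?c < \<tau> / (8 * CARD('p))}" using i by simp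
    qed (simp add: N_def)
    finally show "m * (sqrt k)\<^sup>2 \<le> card {i \<in> N. dist (z i) ?c < \<tau> / (8 * CARD('p))}" .
  qed (use pos m in \<open>auto simp: N_def\<close>)
  have b0_near: "\<bar>b0 \<bullet> z i\<bar> \<le> 1 / 2" if "i \<in> N" for i
  proof -
    have "\<bar>b0 \<bullet> z i\<bar> \<le> norm b0 * norm (z i)" by (rule Cauchy_Schwarz_ineq2)
    also have "\<dots> \<le> norm b0 * (4 * \<tau>)" using near[OF that] by (intro mult_left_mono) auto
    finally show ?thesis using small(2) by linarith
  qed
  note * = penalized_maximizer_localized[OF pos(2) K pos(3,4) s0 sj small(3) curv b0_near
      less_imp_le[OF near] \<kappa> D, unfolded N_def z_def, folded is_maximizer_iff]
  show "\<exists>ab. is_maximizer ys xs n k lam x ab" by (rule *(1))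
  show "is_maximizer ys xs n k lam x (a, b) \<Longrightarrow> \<tau> * norm (b - b0) \<le> D / sqrt k" by (rule *(2))
qed

text \<open>A positive continuous function attains a positive minimum on a compact interval.\<close>

lemma expit_variance_lower:
  obtains \<kappa> where "0 < \<kappa>" "\<And>s. \<bar>s - a0\<bar> \<le> 1 \<Longrightarrow> \<kappa> \<le> expit s * (1 - expit s)"
proof -
  have "continuous_on {a0 - 1..a0 + 1} (\<lambda>s. expit s * (1 - expit s))"
    unfolding expit_def by (intro continuous_intros) (auto simp: one_plus_exp_pos)
  then have "\<exists>s0\<in>{a0 - 1..a0 + 1}. \<forall>s\<in>{a0 - 1..a0 + 1}.
      expit s0 * (1 - expit s0) \<le> expit s * (1 - expit s)"
    by (intro continuous_attains_inf) auto
  then obtain s0 where "\<And>s. s \<in> {a0 - 1..a0 + 1} \<Longrightarrow>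
      expit s0 * (1 - expit s0) \<le> expit s * (1 - expit s)" by blast
  then show ?thesis
    by (intro that[of "expit s0 * (1 - expit s0)"]) (auto simp: expit_bounds abs_le_iff)
qed

text \<open>A crude substitute for the \<open>p\<close>-th root, sufficient where only boundedness
  matters.\<close>

lemma le_of_power_le:
  fixes y B :: real
  assumes "0 \<le> y" "y ^ p \<le> B" "1 \<le> p"
  shows "y \<le> 1 + B"
proof (cases "y \<le> 1")
  case True
  have "0 \<le> y ^ p" using assms by simp
  then show ?thesis using True assms(2) by linarith
next
  case False
  then have "y \<le> y ^ p" using assms(3) by (intro self_le_power) auto
  then show ?thesis using assms(2) by linarith
qed

section \<open>Powers of the neighborhood scale\<close>

lemma tau_pos:
  assumes "0 < f x" "1 \<le> n" "1 \<le> k"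
  shows "0 < tau f n k (x :: real ^ 'p)"
proof -
  have "0 < measure lborel (ball (0 :: real ^ 'p) 1)" by simp
  then show ?thesis using assms by (simp add: tau_def)
qed

lemma tau_power:
  assumes "0 < f x" "1 \<le> n" "1 \<le> k"
  shows "tau f n k (x :: real ^ 'p) ^ CARD('p)
    = k / n * (1 / (f x * measure lborel (ball (0 :: real ^ 'p) 1)))" (is "_ = ?y")
proof -
  have "0 < measure lborel (ball (0 :: real ^ 'p) 1)" by simp
  then have "0 < ?y" using assms by simp
  moreover have "(y powr (1 / CARD('p))) ^ CARD('p) = y" if "0 < y" for y :: real
    using that by (simp add: powr_power)
  ultimately have "(?y powr (1 / CARD('p))) ^ CARD('p) = ?y" by blast
  then show ?thesis by (simp add: tau_def)
qed

lemma sqrt_power_powr: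
  assumes "0 \<le> (t::real)" "0 < p"
  shows "sqrt t ^ p = t powr (p / 2)"
  using assms by (simp add: powr_half_sqrt[symmetric] powr_realpow'[symmetric] powr_powr)

text \<open>Translates the conditions on \<open>k^(1 + p/2) / n\<close> into conditions on the
  reciprocal of the stochastic rate.\<close>

lemma tau_sqrt_power:
  assumes "0 < f x" "1 \<le> n" "1 \<le> k"
  shows "(tau f n k (x :: real ^ 'p) * sqrt k) ^ CARD('p)
    = k powr (1 + CARD('p) / 2) / n * (1 / (f x * measure lborel (ball (0 :: real ^ 'p) 1)))"
  using assms
  by (simp add: power_mult_distrib tau_power sqrt_power_powr powr_add)

text \<open>The quantity \<open>\<tau>^2 * sqrt k\<close> measures bias against noise:
  \<open>k * \<tau>^2\<close> divided by \<open>sqrt k\<close>. The exponent \<open>1 + p/4\<close>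
  is the one that keeps it bounded.\<close>

lemma tau_sq_sqrt_power:
  assumes "0 < f x" "1 \<le> n" "1 \<le> k"
  shows "((tau f n k (x :: real ^ 'p))\<^sup>2 * sqrt k) ^ CARD('p)
    = (k powr (1 + CARD('p) / 4) / n * (1 / (f x * measure lborel (ball (0 :: real ^ 'p) 1))))\<^sup>2"
proof -
  have "(k powr (CARD('p) / 4))\<^sup>2 = k powr (CARD('p) / 2)"
    using assms by (simp add: powr_power)
  moreover have "((tau f n k x)\<^sup>2) ^ CARD('p) = (tau f n k x ^ CARD('p))\<^sup>2"
    by (simp add: power_mult[symmetric] mult.commute)
  ultimately show ?thesis
    using assms
    by (simp add: power_mult_distrib tau_power sqrt_power_powr powr_add power_divide)
qed

section \<open>Rates and stochastic bounds\<close>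

lemma tau_asymptotics:
  fixes f :: "real ^ 'p \<Rightarrow> real" and k :: "nat \<Rightarrow> nat" and lam :: "nat \<Rightarrow> real"
  assumes "0 < f x" and k: "\<And>n. n \<ge> 1 \<Longrightarrow> k n \<in> {1..n}" and lam: "\<And>n. n \<ge> 1 \<Longrightarrow> lam n \<ge> 0"
    and k_lim: "filterlim k at_top sequentially"
    and rate_lower: "filterlim (\<lambda>n. real (k n) powr (1 + real CARD('p) / 2) / real n) at_top sequentially"
    and rate_upper: "Bseq (\<lambda>n. real (k n) powr (1 + real CARD('p) / 4) / real n)"
    and penalty: "(\<lambda>n. real n * lam n ^ CARD('p) / real (k n) powr (1 + real CARD('p) / 2))
           \<longlonglongrightarrow> c"
  obtains T L where "\<And>n. n \<ge> 1 \<Longrightarrow> (tau f n (k n) x)\<^sup>2 * sqrt (k n) \<le> T"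
    "\<forall>\<^sub>F n in sequentially. lam n \<le> L * sqrt (k n) * tau f n (k n) x"
    "filterlim (\<lambda>n. tau f n (k n) x * sqrt (k n)) at_top sequentially"
    "(\<lambda>n. tau f n (k n) x) \<longlonglongrightarrow> 0"
proof -
  define \<tau> where "\<tau> n = tau f n (k n) x" for n
  define w where "w = 1 / (f x * measure lborel (ball (0 :: real ^ 'p) 1))"
  have w: "0 < w" using assms(1) by (simp add: w_def)
  have p: "0 < CARD('p)" by simp
  have k1: "1 \<le> k n" if "n \<ge> 1" for n using k[OF that] by simp
  have pos: "0 < \<tau> n" if "n \<ge> 1" for n
    unfolding \<tau>_def using tau_pos[of f x, OF assms(1) that k1[OF that]] .
  have pow1: "(\<tau> n * sqrt (k n)) ^ CARD('p) = real (k n) powr (1 + CARD('p) / 2) / n * w" if "n \<ge> 1" for n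
    unfolding \<tau>_def w_def by (rule tau_sqrt_power[of f x, OF assms(1) that k1[OF that]])
  have pow2: "((\<tau> n)\<^sup>2 * sqrt (k n)) ^ CARD('p) = (real (k n) powr (1 + CARD('p) / 4) / n * w)\<^sup>2"
    if "n \<ge> 1" for n
    unfolding \<tau>_def w_def by (rule tau_sq_sqrt_power[of f x, OF assms(1) that k1[OF that]])
  obtain B where B: "\<And>n. norm (real (k n) powr (1 + real CARD('p) / 4) / real n) \<le> B"
    using rate_upper unfolding Bseq_def by blast
  define T where "T = 1 + (B * w)\<^sup>2"
  have T: "(\<tau> n)\<^sup>2 * sqrt (k n) \<le> T" if "n \<ge> 1" for n
    unfolding T_def
  proof (rule le_of_power_le)
    show "((\<tau> n)\<^sup>2 * sqrt (k n)) ^ CARD('p) \<le> (B * w)\<^sup>2"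
      unfolding pow2[OF that] using B[of n] w by (intro power_mono mult_right_mono) auto
  qed (auto simp: Suc_le_eq)
  have big: "filterlim (\<lambda>n. \<tau> n * sqrt (k n)) at_top sequentially"
    unfolding filterlim_at_top_gt[where c = 0]
  proof (intro allI impI)
    fix Z :: real assume Z: "0 < Z"
    \<comment> \<open>The threshold is chosen so that \<open>pow1\<close> turns it into a comparison
      of \<open>p\<close>-th powers with \<open>Z\<close>.\<close>
    have "\<forall>\<^sub>F n in sequentially. Z ^ CARD('p) / w \<le> real (k n) powr (1 + real CARD('p) / 2) / real n"
      using rate_lower unfolding filterlim_at_top by blast
    then show "\<forall>\<^sub>F n in sequentially. Z \<le> \<tau> n * sqrt (k n)"
      using eventually_ge_at_top[of 1]
    proof eventually_elim
      case (elim n)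
      then have "Z ^ CARD('p) \<le> (\<tau> n * sqrt (k n)) ^ CARD('p)"
        unfolding pow1[OF elim(2)] using w by (simp add: pos_divide_le_eq)
      then show ?case
        using Z pos[OF elim(2)] p by (simp add: power_mono_iff)
    qed
  qed
  have zero: "\<tau> \<longlonglongrightarrow> 0"
  proof -
    have "filterlim (\<lambda>n. sqrt (real (k n))) at_top sequentially"
      by (intro filterlim_compose[OF sqrt_at_top] filterlim_compose[OF filterlim_real_sequentially] k_lim)
    then have lim: "(\<lambda>n. T / sqrt (real (k n))) \<longlonglongrightarrow> 0"
      by (intro real_tendsto_divide_at_top[OF tendsto_const])
    \<comment> \<open>The scale tends to 0 because \<open>\<tau>^2 * sqrt k\<close> stays bounded
      while \<open>sqrt k\<close> diverges.\<close>
    have le: "\<forall>\<^sub>F n in sequentially. (\<tau> n)\<^sup>2 \<le> T / sqrt (real (k n))"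
      using eventually_ge_at_top[of 1]
    proof eventually_elim
      case (elim n)
      then show ?case using T[OF elim] k1[OF elim] by (simp add: pos_le_divide_eq)
    qed
    have "(\<lambda>n. (\<tau> n)\<^sup>2) \<longlonglongrightarrow> 0"
      by (rule tendsto_sandwich[OF always_eventually le tendsto_const lim]) simp
    from tendsto_real_sqrt[OF this] have "(\<lambda>n. \<bar>\<tau> n\<bar>) \<longlonglongrightarrow> 0" by simp
    then show ?thesis by (rule tendsto_rabs_zero_cancel)
  qed
  \<comment> \<open>The normalized penalty is eventually below \<open>c + 1\<close>; dividing by
    \<open>w\<close> passes to \<open>(lam / (\<tau> * sqrt k)) ^ p\<close>, and the leading 1 comes
    from \<open>le_of_power_le\<close>.\<close>
  define L where "L = 1 + (c + 1) / w"
  have "\<forall>\<^sub>F n in sequentially. real n * lam n ^ CARD('p) / real (k n) powr (1 + real CARD('p) / 2) < c + 1"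
    using order_tendstoD(2)[OF penalty, of "c + 1"] by simp
  then have "\<forall>\<^sub>F n in sequentially. lam n \<le> L * sqrt (k n) * \<tau> n"
    using eventually_ge_at_top[of 1]
  proof eventually_elim
    case (elim n)
    let ?r = "real (k n) powr (1 + real CARD('p) / 2)"
    have r: "0 < ?r" "0 < real n" using elim k1[OF elim(2)] by auto
    have s: "0 < \<tau> n * sqrt (k n)" using pos[OF elim(2)] k1[OF elim(2)] by simp
    have "lam n ^ CARD('p) \<le> (c + 1) * ?r / n"
      using elim(1) r by (simp add: field_simps)
    also have "\<dots> = (c + 1) / w * (\<tau> n * sqrt (k n)) ^ CARD('p)"
      unfolding pow1[OF elim(2)] using w by simp
    finally have "(lam n / (\<tau> n * sqrt (k n))) ^ CARD('p) \<le> (c + 1) / w"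
      unfolding power_divide using s by (simp only: pos_divide_le_eq zero_less_power)
    then have "lam n / (\<tau> n * sqrt (k n)) \<le> L"
      unfolding L_def using s lam[OF elim(2)] by (intro le_of_power_le) (auto simp: Suc_le_eq)
    then show ?case using s by (simp add: pos_divide_le_eq mult_ac)
  qed
  then show ?thesis
    using that T big zero unfolding \<tau>_def by blast
qed

text \<open>Order of the constants: \<open>A\<close> depends on \<open>\<epsilon>\<close> and limits
  the noise events to probability \<open>\<epsilon> / 2\<close>; \<open>D\<close> depends on
  \<open>A\<close> and makes curvature win; then \<open>n\<close> is taken so large that the
  counting events cost at most \<open>\<epsilon> / 2\<close> and all local approximations are
  valid.\<close>

lemma (in prob_space) estimator_tail:
  fixes X :: "'a \<Rightarrow> real ^ 'p" and Xs :: "nat \<Rightarrow> 'a \<Rightarrow> real ^ 'p" and f \<pi> :: "real ^ 'p \<Rightarrow> real"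
    and k :: "nat \<Rightarrow> nat" and lam :: "nat \<Rightarrow> real" and \<epsilon> :: real
  assumes YX: "Y \<in> borel_measurable M" "X \<in> borel_measurable M"
    and Ys01: "\<And>i \<omega>. i \<ge> 1 \<Longrightarrow> \<omega> \<in> space M \<Longrightarrow> Ys i \<omega> \<in> {0, 1}"
    and copies: "independent_copies M Ys Xs Y X"
    and reg: "is_regression_function M Y X \<pi>"
    and dens: "distributed M lborel X (\<lambda>z. ennreal (f z))" "\<And>z. 0 \<le> f z" "isCont f x" "f x > 0"
    and smooth: "C2_at \<pi> x" "0 < \<pi> x" "\<pi> x < 1"
    and k: "\<And>n. n \<ge> 1 \<Longrightarrow> k n \<in> {1..n}" and lam: "\<And>n. n \<ge> 1 \<Longrightarrow> lam n \<ge> 0"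
    and est: "\<And>n. n \<ge> 1 \<Longrightarrow> is_estimator M Ys Xs n (k n) (lam n) x (a_hat n) (b_hat n)"
    and k_lim: "filterlim k at_top sequentially"
    and T: "\<And>n. n \<ge> 1 \<Longrightarrow> (tau f n (k n) x)\<^sup>2 * sqrt (k n) \<le> T"
    and L: "\<forall>\<^sub>F n in sequentially. lam n \<le> L * sqrt (k n) * tau f n (k n) x"
    and tau_lim: "(\<lambda>n. tau f n (k n) x) \<longlonglongrightarrow> 0"
    and "0 < \<epsilon>"
  obtains D where "0 < D"
    "\<forall>\<^sub>F n in sequentially. prob {\<omega> \<in> space M.
       norm (b_hat n \<omega> - gradient (\<lambda>z. logit (\<pi> z)) x) > D * (1 / (tau f n (k n) x * sqrt (k n)))} \<le> \<epsilon>"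
proof -
  define p where "p = CARD('p)"
  define V where "V = measure lborel (ball (0 :: real ^ 'p) 1)"
  define b0 where "b0 = gradient (\<lambda>z. logit (\<pi> z)) x"
  define a0 where "a0 = logit (\<pi> x)"
  define \<tau> where "\<tau> n = tau f n (k n) x" for n
  have V: "0 < V" by (simp add: V_def)
  obtain \<kappa> where \<kappa>: "0 < \<kappa>" "\<And>s. \<bar>s - a0\<bar> \<le> 1 \<Longrightarrow> \<kappa> \<le> expit s * (1 - expit s)"
    using expit_variance_lower[of a0] by blast
  obtain C d where C: "0 \<le> C" "0 < d"
    "\<And>z. dist z x < d \<Longrightarrow> \<bar>\<pi> z - expit (a0 + b0 \<bullet> (z - x))\<bar> \<le> C * (dist z x)\<^sup>2"
    unfolding a0_def b0_def using expit_tangent_bias[OF smooth] by blast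
  obtain \<rho> where \<rho>: "0 < \<rho>"
    "\<And>y r. 0 \<le> r \<Longrightarrow> dist x y + r \<le> \<rho> \<Longrightarrow>
       f x / 2 * (r ^ p * V) \<le> prob {\<omega> \<in> space M. X \<omega> \<in> ball y r} \<and>
       prob {\<omega> \<in> space M. X \<omega> \<in> ball y r} \<le> 3 / 2 * f x * (r ^ p * V)"
    using density_ball_mass[OF dens] unfolding V_def p_def by auto
  \<comment> \<open>The solution of \<open>16 * (p + 1) / A^2 = \<epsilon> / 2\<close>.\<close>
  define A where "A = sqrt (32 * (p + 1) / \<epsilon>)"
  have A: "0 < A" "16 * (p + 1) / A\<^sup>2 = \<epsilon> / 2"
    using \<open>0 < \<epsilon>\<close> by (auto simp: A_def field_simps)
  define m where "m = (1 / (8 * CARD('p))) ^ CARD('p) / 4"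
  define m' where "m' = m / (64 * (real CARD('p))\<^sup>2)"
  have m': "0 < m'" by (simp add: m_def m'_def)
  \<comment> \<open>The summand 1 makes the curvature inequality strict, and the absolute value
    makes \<open>D\<close> positive.\<close>
  define D where "D = 2 * (\<bar>A + 64 * C * T + L\<bar> + 1) / (\<kappa> * m')"
  have D: "0 < D" 
    unfolding D_def using \<kappa>(1) m' by (intro divide_pos_pos mult_pos_pos add_nonneg_pos) auto
  have D_large: "A + 64 * C * T + L < \<kappa> * m' / 2 * D"
  proof -
    have "\<kappa> * m' / 2 * D = \<bar>A + 64 * C * T + L\<bar> + 1"
      using \<kappa>(1) m' by (simp add: D_def)
    then show ?thesis by linarith
  qed
  define E where "E = 14 + 16 * real p * (8 * p) ^ p"
  \<comment> \<open>For \<open>\<tau> < \<delta>\<close>, the radius \<open>4 * \<tau>\<close> is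
    within the range of the density bounds and of the bias bound, and \<open>b0\<close> moves the
    linear predictor by at most \<open>1 / 2\<close> over it.\<close>
  define \<delta> where "\<delta> = Min {\<rho> / 4, d / 4, 1 / (8 * (norm b0 + 1))}"
  have \<delta>: "0 < \<delta>" "\<delta> \<le> \<rho> / 4" "\<delta> \<le> d / 4" "\<delta> \<le> 1 / (8 * (norm b0 + 1))"
    using \<rho>(1) C(2) by (auto simp: \<delta>_def add_nonneg_pos)
  have ev_tau: "\<forall>\<^sub>F n in sequentially. \<tau> n < \<delta>"
    using order_tendstoD(2)[OF tau_lim \<delta>(1)] by (simp add: \<tau>_def)
  have ev_k: "\<forall>\<^sub>F n in sequentially. nat \<lceil>max (2 * E / \<epsilon>) ((8 * D)\<^sup>2)\<rceil> \<le> k n"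
    using k_lim unfolding filterlim_at_top by blast
  have "\<forall>\<^sub>F n in sequentially. prob {\<omega> \<in> space M. norm (b_hat n \<omega> - b0) > D * (1 / (\<tau> n * sqrt (k n)))} \<le> \<epsilon>"
    using ev_tau ev_k L eventually_ge_at_top[of 1]
  proof eventually_elim
    case (elim n)
    note n = elim(4)
    have kn: "1 \<le> k n" "k n \<le> n" using k[OF n] by auto
    have \<tau>: "0 < \<tau> n" unfolding \<tau>_def by (rule tau_pos[of f x, OF dens(4) n kn(1)])
    have k_large: "2 * E / \<epsilon> \<le> k n" "(8 * D)\<^sup>2 \<le> k n"
      using elim(2) by (auto simp: nat_le_iff ceiling_le_iff)
    have K: "0 < sqrt (k n)" using kn by simp
    \<comment> \<open>The defining equation of the scale: a ball of radius \<open>\<tau> n\<close>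
      would contain \<open>k n\<close> points on average if the density were constantly
      \<open>f x\<close>.\<close>
    have tau_p: "\<tau> n ^ p * (f x * V) * n = k n"
      using tau_power[of f x n "k n"] dens(4) V n kn unfolding \<tau>_def p_def V_def by simp
    have mass: "a ^ CARD('p) * k n / 2 \<le> n * prob {\<omega> \<in> space M. X \<omega> \<in> ball y (a * \<tau> n)} \<and>
      n * prob {\<omega> \<in> space M. X \<omega> \<in> ball y (a * \<tau> n)} \<le> 3 / 2 * a ^ CARD('p) * k n"
      if "0 \<le> a" "dist x y + a * \<tau> n \<le> 4 * \<tau> n" for y and a :: real
    proof -
      have "dist x y + a * \<tau> n \<le> \<rho>" using that(2) elim(1) \<delta>(2) by linarith
      then have P: "f x / 2 * ((a * \<tau> n) ^ p * V) \<le> prob {\<omega> \<in> space M. X \<omega> \<in> ball y (a * \<tau> n)}"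
        "prob {\<omega> \<in> space M. X \<omega> \<in> ball y (a * \<tau> n)} \<le> 3 / 2 * f x * ((a * \<tau> n) ^ p * V)"
        using \<rho>(2)[of "a * \<tau> n" y] that(1) \<tau> by auto
      have eq: "n * (f x / 2 * ((a * \<tau> n) ^ p * V)) = a ^ p * (\<tau> n ^ p * (f x * V) * n) / 2"
        "n * (3 / 2 * f x * ((a * \<tau> n) ^ p * V)) = 3 / 2 * a ^ p * (\<tau> n ^ p * (f x * V) * n)"
        by (simp_all add: power_mult_distrib)
      have "n * (f x / 2 * ((a * \<tau> n) ^ p * V)) \<le> n * prob {\<omega> \<in> space M. X \<omega> \<in> ball y (a * \<tau> n)}"
        "n * prob {\<omega> \<in> space M. X \<omega> \<in> ball y (a * \<tau> n)} \<le> n * (3 / 2 * f x * ((a * \<tau> n) ^ p * V))"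
        by (rule mult_left_mono[OF P(1)], simp, rule mult_left_mono[OF P(2)], simp)
      then show ?thesis
        unfolding eq tau_p unfolding p_def by (rule conjI)
    qed
    obtain Bad where Bad: "Bad \<in> events"
      "prob Bad \<le> (14 + 16 * real CARD('p) * (8 * CARD('p)) ^ CARD('p)) / k n + 16 * (CARD('p) + 1) / A\<^sup>2"
      "\<And>\<omega>. \<omega> \<in> space M - Bad \<Longrightarrow> k n \<le> card {j \<in> {1..n}. dist (Xs j \<omega>) x < 4 * \<tau> n}"
      "\<And>\<omega>. \<omega> \<in> space M - Bad \<Longrightarrow> card {j \<in> {1..n}. dist (Xs j \<omega>) x < \<tau> n / 2} \<le> k n"
      "\<And>\<omega> j s. \<omega> \<in> space M - Bad \<Longrightarrow> s \<in> {-1, 1} \<Longrightarrow> (1 / (8 * CARD('p))) ^ CARD('p) / 4 * k n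
         \<le> card {i \<in> {1..n}. dist (Xs i \<omega>) (x + (s * \<tau> n / 4) *\<^sub>R axis j 1) < \<tau> n / (8 * CARD('p))}"
      "\<And>\<omega>. \<omega> \<in> space M - Bad \<Longrightarrow>
       \<bar>\<Sum>i\<in>nearest_neighbors (\<lambda>i. Xs i \<omega>) n (k n) x. residual \<pi> (Ys i \<omega>, Xs i \<omega>)\<bar> \<le> A * sqrt (k n)"
      "\<And>\<omega> j. \<omega> \<in> space M - Bad \<Longrightarrow>
       \<bar>\<Sum>i\<in>nearest_neighbors (\<lambda>i. Xs i \<omega>) n (k n) x. residual \<pi> (Ys i \<omega>, Xs i \<omega>) *
          (indicator (ball x (4 * \<tau> n)) (Xs i \<omega>) * (Xs i \<omega> - x) $ j / \<tau> n)\<bar> \<le> A * sqrt (k n)"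
      by (rule sample_regularity[OF YX copies reg kn(1) \<tau> A(1) mass]) (assumption | rule that)+
    have res: "(\<Sum>i\<in>nearest_neighbors (\<lambda>i. Xs i \<omega>) n (k n) x. residual \<pi> (Ys i \<omega>, Xs i \<omega>) * w i)
      = (\<Sum>i\<in>nearest_neighbors (\<lambda>i. Xs i \<omega>) n (k n) x. (Ys i \<omega> - \<pi> (Xs i \<omega>)) * w i)"
      if "\<omega> \<in> space M" for \<omega> w
    proof (rule sum.cong[OF refl])
      fix i assume "i \<in> nearest_neighbors (\<lambda>i. Xs i \<omega>) n (k n) x"
      then have "Ys i \<omega> \<in> {0, 1}" by (intro Ys01 that) (auto simp: nearest_neighbors_def)
      then show "residual \<pi> (Ys i \<omega>, Xs i \<omega>) * w i = (Ys i \<omega> - \<pi> (Xs i \<omega>)) * w i"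
        by (auto simp: residual_def)
    qed
    have good: "(\<exists>ab. is_maximizer (\<lambda>i. Ys i \<omega>) (\<lambda>i. Xs i \<omega>) n (k n) (lam n) x ab) \<and>
        (\<forall>a b. is_maximizer (\<lambda>i. Ys i \<omega>) (\<lambda>i. Xs i \<omega>) n (k n) (lam n) x (a, b) \<longrightarrow>
           \<tau> n * norm (b - b0) \<le> D / sqrt (k n))"
      if \<omega>: "\<omega> \<in> space M - Bad" for \<omega>
    proof -
      have score0: "\<bar>\<Sum>i\<in>nearest_neighbors (\<lambda>i. Xs i \<omega>) n (k n) x. Ys i \<omega> - \<pi> (Xs i \<omega>)\<bar> \<le> A * sqrt (k n)"
        using Bad(6)[OF \<omega>] res[of \<omega> "\<lambda>_. 1"] \<omega> by simp
      have score: "\<bar>\<Sum>i\<in>nearest_neighbors (\<lambda>i. Xs i \<omega>) n (k n) x. (Ys i \<omega> - \<pi> (Xs i \<omega>)) *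
          (indicator (ball x (4 * \<tau> n)) (Xs i \<omega>) * (Xs i \<omega> - x) $ j / \<tau> n)\<bar> \<le> A * sqrt (k n)" for j
        using Bad(7)[OF \<omega>, of j] unfolding res[OF DiffD1[OF \<omega>]] .
      have bias: "\<bar>\<pi> z - expit (a0 + b0 \<bullet> (z - x))\<bar> \<le> C * (dist z x)\<^sup>2" if "dist z x < 4 * \<tau> n" for z
        using that elim(1) \<delta>(3) by (intro C(3)) linarith
      have b0: "norm b0 * (4 * \<tau> n) \<le> 1 / 2"
      proof -
        have "norm b0 * (4 * \<tau> n) \<le> (norm b0 + 1) * (4 * (1 / (8 * (norm b0 + 1))))"
          using elim(1) \<delta>(4) \<tau> by (intro mult_mono) auto
        also have "\<dots> = 1 / 2"
          using norm_ge_zero[of b0] by (simp add: add_nonneg_eq_0_iff)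
        finally show ?thesis .
      qed
      have D8: "8 * D \<le> sqrt (k n)" using k_large(2) by (rule real_le_rsqrt)
      note loc = maximizer_on_regular_sample[OF kn(1) \<tau> lam[OF n] D C(1) Bad(3)[OF \<omega>] Bad(4)[OF \<omega>]
          Bad(5)[OF \<omega>] score0 score bias T[OF n, folded \<tau>_def] b0
          elim(3)[folded \<tau>_def] \<kappa> D8 D_large[unfolded m'_def m_def]]
      show ?thesis using loc by blast
    qed
    \<comment> \<open>Off \<open>Bad\<close> a maximizer exists, so almost surely the estimator is
      one and the localization applies to it. Existence is essential here, since the estimator is
      otherwise arbitrary.\<close>
    have "AE \<omega> in M. \<omega> \<in> {\<omega> \<in> space M. norm (b_hat n \<omega> - b0) > D * (1 / (\<tau> n * sqrt (k n)))} \<longrightarrow> \<omega> \<in> Bad"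
    proof (rule AE_mp[OF est[OF n, unfolded is_estimator_def, THEN conjunct2, THEN conjunct2]],
        rule AE_I2, intro impI, rule ccontr)
      fix \<omega>
      assume max: "(\<exists>ab. is_maximizer (\<lambda>i. Ys i \<omega>) (\<lambda>i. Xs i \<omega>) n (k n) (lam n) x ab) \<longrightarrow>
          is_maximizer (\<lambda>i. Ys i \<omega>) (\<lambda>i. Xs i \<omega>) n (k n) (lam n) x (a_hat n \<omega>, b_hat n \<omega>)"
        and \<omega>: "\<omega> \<in> {\<omega> \<in> space M. norm (b_hat n \<omega> - b0) > D * (1 / (\<tau> n * sqrt (k n)))}" "\<omega> \<notin> Bad"
      then have "\<tau> n * norm (b_hat n \<omega> - b0) \<le> D / sqrt (k n)"
        using good[of \<omega>] by blast
      then have "norm (b_hat n \<omega> - b0) \<le> D / sqrt (k n) / \<tau> n"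
        using \<tau> by (simp only: pos_le_divide_eq mult.commute)
      then show False using \<omega>(1) by (simp add: mult.commute)
    qed
    then have "prob {\<omega> \<in> space M. norm (b_hat n \<omega> - b0) > D * (1 / (\<tau> n * sqrt (k n)))} \<le> prob Bad"
      using Bad(1) by (rule finite_measure_mono_AE)
    also have "\<dots> \<le> E / k n + \<epsilon> / 2" 
      using Bad(2)[folded p_def, folded E_def] unfolding A(2) .
    also have "E / k n \<le> \<epsilon> / 2"
      using k_large(1) kn(1) \<open>0 < \<epsilon>\<close> by (simp add: field_simps)
    finally show ?case by simp
  qed
  then show ?thesis
    using that[OF D] unfolding \<tau>_def b0_def by blast
qed

theorem corollary3:
  fixes M :: "'w measure"
    and Y :: "'w \<Rightarrow> real" and X :: "'w \<Rightarrow> real ^ 'p"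
    and Ys :: "nat \<Rightarrow> 'w \<Rightarrow> real" and Xs :: "nat \<Rightarrow> 'w \<Rightarrow> real ^ 'p"
    and f :: "real ^ 'p \<Rightarrow> real" and \<pi> :: "real ^ 'p \<Rightarrow> real"
    and x :: "real ^ 'p"
    and k :: "nat \<Rightarrow> nat" and lam :: "nat \<Rightarrow> real" and c :: real
    and a_hat :: "nat \<Rightarrow> 'w \<Rightarrow> real" and b_hat :: "nat \<Rightarrow> 'w \<Rightarrow> real ^ 'p"
  assumes "prob_space M"
    and "Y \<in> borel_measurable M" "X \<in> borel_measurable M"
    and "\<And>\<omega>. \<omega> \<in> space M \<Longrightarrow> Y \<omega> \<in> {0, 1}"
    and "\<And>i \<omega>. i \<ge> 1 \<Longrightarrow> \<omega> \<in> space M \<Longrightarrow> Ys i \<omega> \<in> {0, 1}"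
    and "independent_copies M Ys Xs Y X"
    and "is_regression_function M Y X \<pi>"
    and A1: "distributed M lborel X (\<lambda>z. ennreal (f z))" "\<And>z. 0 \<le> f z"
            "continuous_on UNIV f" "f x > 0"
    and A2: "C2_at \<pi> x" "0 < \<pi> x" "\<pi> x < 1"
    and "\<And>n. n \<ge> 1 \<Longrightarrow> k n \<in> {1..n}"
    and "\<And>n. n \<ge> 1 \<Longrightarrow> lam n \<ge> 0"
    and "\<And>n. n \<ge> 1 \<Longrightarrow> is_estimator M Ys Xs n (k n) (lam n) x (a_hat n) (b_hat n)"
    and "filterlim k at_top sequentially"
    and "filterlim (\<lambda>n. real (k n) powr (1 + real CARD('p) / 2) / real n) at_top sequentially"
    and "Bseq (\<lambda>n. real (k n) powr (1 + real CARD('p) / 4) / real n)"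
    and "c \<ge> 0"
    and "(\<lambda>n. real n * lam n ^ CARD('p) / real (k n) powr (1 + real CARD('p) / 2))
           \<longlonglongrightarrow> c"
  shows "converges_in_prob M b_hat (gradient (\<lambda>z. logit (\<pi> z)) x) \<and>
    (\<exists>U V. bigO_prob M U (\<lambda>n. 1 / (tau f n (k n) x * sqrt (real (k n)))) \<and>
           bigO_prob M V (\<lambda>n. tau f n (k n) x) \<and>
           (\<forall>n\<ge>1. \<forall>\<omega>\<in>space M.
              b_hat n \<omega> - gradient (\<lambda>z. logit (\<pi> z)) x = U n \<omega> + V n \<omega>))"
proof -
  interpret prob_space M by (rule assms(1))
  define b0 where "b0 = gradient (\<lambda>z. logit (\<pi> z)) x"
  define s where "s n = tau f n (k n) x * sqrt (k n)" for n
  obtain T L where T: "\<And>n. n \<ge> 1 \<Longrightarrow> (tau f n (k n) x)\<^sup>2 * sqrt (k n) \<le> T"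
    and L: "\<forall>\<^sub>F n in sequentially. lam n \<le> L * sqrt (k n) * tau f n (k n) x"
    and ts_lim: "filterlim (\<lambda>n. tau f n (k n) x * sqrt (k n)) at_top sequentially"
    and tau_lim: "(\<lambda>n. tau f n (k n) x) \<longlonglongrightarrow> 0"
    by (rule tau_asymptotics[of f x k lam c, OF A1(4) assms(15,16) assms(18-20) assms(22)])
       (assumption | rule that)+
  have s_lim: "filterlim s at_top sequentially"
    using ts_lim by (simp add: s_def[abs_def])
  have cont: "isCont f x"
    using A1(3) by (simp add: continuous_on_eq_continuous_at)
  have tail: "\<exists>D>0. \<forall>\<^sub>F n in sequentially. prob {\<omega> \<in> space M. norm (b_hat n \<omega> - b0) > D * (1 / s n)} \<le> \<epsilon>"
    if "0 < \<epsilon>" for \<epsilon>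
    unfolding s_def b0_def
    by (rule estimator_tail[OF assms(2,3,5-7) A1(1,2) cont A1(4) A2 assms(15-18) T L tau_lim that])
       (assumption | rule exI conjI)+
  have meas: "b_hat n \<in> borel_measurable M" if "n \<ge> 1" for n
    using assms(17)[OF that] by (simp add: is_estimator_def)
  have ev_meas: "\<forall>\<^sub>F n in sequentially. b_hat n \<in> borel_measurable M"
    using eventually_ge_at_top[of 1] by eventually_elim (rule meas)
  have "converges_in_prob M b_hat b0"
    unfolding converges_in_prob_def
  proof (intro conjI allI impI ev_meas)
    fix e :: real assume e: "0 < e"
    let ?P = "\<lambda>n. prob {\<omega> \<in> space M. dist (b_hat n \<omega>) b0 > e}"
    show "?P \<longlonglongrightarrow> 0"
    proof (rule tendstoI)
      fix \<epsilon> :: real assume "0 < \<epsilon>"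
      then obtain D where D: "0 < D"
        "\<forall>\<^sub>F n in sequentially. prob {\<omega> \<in> space M. norm (b_hat n \<omega> - b0) > D * (1 / s n)} \<le> \<epsilon> / 2"
        using tail[of "\<epsilon> / 2"] by auto
      \<comment> \<open>Beyond this threshold the tail radius \<open>D * (1 / s n)\<close> is at
        most \<open>e\<close>, so the stochastic bound also controls deviations by
        \<open>e\<close>.\<close>
      have "\<forall>\<^sub>F n in sequentially. D / e \<le> s n"
        using s_lim unfolding filterlim_at_top by blast
      with D(2) eventually_ge_at_top[of 1]
      show "\<forall>\<^sub>F n in sequentially. dist (?P n) 0 < \<epsilon>"
      proof eventually_elim
        case (elim n)
        note [measurable] = meas[OF elim(2)]
        have "0 < D / e" using D(1) e by simp
        then have "0 < s n" using elim(3) by linarith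
        then have "D * (1 / s n) \<le> e" using elim(3) e by (simp add: field_simps)
        then have "?P n \<le> prob {\<omega> \<in> space M. norm (b_hat n \<omega> - b0) > D * (1 / s n)}"
          by (intro finite_measure_mono) (auto simp: dist_norm)
        then show ?case using elim(1) \<open>0 < \<epsilon>\<close> by simp
      qed
    qed
  qed
  moreover have "bigO_prob M (\<lambda>n \<omega>. b_hat n \<omega> - b0) (\<lambda>n. 1 / s n)"
    unfolding bigO_prob_def
  proof (intro conjI allI impI)
    show "\<forall>\<^sub>F n in sequentially. (\<lambda>\<omega>. b_hat n \<omega> - b0) \<in> borel_measurable M"
      using ev_meas by eventually_elim simp
  qed (use tail in blast)
  text \<open>Since \<open>\<tau>\<^sup>2 \<surd>k\<close> is bounded, the second rate is dominated by the first, and the second summand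
    can be taken to be zero.\<close>
  moreover have "bigO_prob M (\<lambda>n \<omega>. 0 :: real ^ 'p) (\<lambda>n. tau f n (k n) x)"
    unfolding bigO_prob_def by (auto intro!: exI[of _ 0])
  ultimately show ?thesis
    unfolding s_def b0_def by (intro conjI exI[of _ "\<lambda>n \<omega>. b_hat n \<omega> - gradient (\<lambda>z. logit (\<pi> z)) x"]
        exI[of _ "\<lambda>n \<omega>. 0"]) auto
qed

end
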